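(* Let $X \in \mathcal{B}$ and let $R = R(X) = \bigoplus_{\rho \in T_{cr}(X)} R_\rho$ be the homogeneous decomposition of its regulator. Suppose that $X = X_1 \oplus \cdots \oplus X_s$ is an indecomposable decomposition of $X$. Then $\operatorname{rk}(R_\tau) \leq s$ for all $\tau \in T_{cr}(X)$. In particular, if $X$ realizes a partition $(r_1,r_2)$ with two parts, then $\operatorname{rk}(R_\tau) \leq 2$ for all $\tau \in T_{cr}(X)$.
   Context: All groups are torsion-free abelian of finite rank. An indecomposable decomposition is a direct decomposition into nonzero indecomposable summands; if the summands have ranks $r_1,\dots,r_t$, the group is said to realize the (unordered) partition $(r_1,\dots,r_t)$ of its rank. Types are isomorphism classes of rank-one groups, with $\sigma\le\tau$ iff there is a nonzero homomorphism from a group of type $\sigma$ to one of type $\tau$. A completely decomposable group is a direct sum of rank-one groups; its homogeneous decomposition is $A=\bigoplus_{\rho\in T_{cr}(A)}A_\rho$, where $A_\rho\neq 0$ is a direct sum of rank-one groups of type $\rho$, and $T_{cr}(A)$ is the critical typeset. An almost completely decomposable group is a group $X$ containing a completely decomposable subgroup of finite index; the completely decomposable subgroups of least index in $X$ are its regulating subgroups, and the regulator $R(X)$ is the intersection of all of them (it is completely decomposable, fully invariant, of finite index in $X$). Put $T_{cr}(X)=T_{cr}(R(X))$. $X$ is block-rigid if $T_{cr}(X)$ is an antichain. $\mathcal{B}$ is the class of block-rigid almost completely decomposable groups $X$ with $X/R(X)$ cyclic. *)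

theory Defs
  imports "HOL-Algebra.Product_Groups" "HOL-Algebra.FiniteProduct" "HOL-Library.Multiset" "HOL.Rat"
begin

text \<open>
  Abelian groups are written multiplicatively, following the library; a subgroup \<open>H\<close> of \<open>G\<close>
  is regarded as the group \<open>G\<lparr>carrier := H\<rparr>\<close>.
\<close>

definition torsion_free_group :: "('a, 'b) monoid_scheme \<Rightarrow> bool"
  where "torsion_free_group G \<longleftrightarrow>
    (\<forall>x \<in> carrier G. \<forall>n::nat. 0 < n \<and> x [^]\<^bsub>G\<^esub> n = \<one>\<^bsub>G\<^esub> \<longrightarrow> x = \<one>\<^bsub>G\<^esub>)"

definition int_independent :: "('a, 'b) monoid_scheme \<Rightarrow> 'a set \<Rightarrow> bool"
  where "int_independent G S \<longleftrightarrow> finite S \<and> S \<subseteq> carrier G \<and>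
    (\<forall>c :: 'a \<Rightarrow> int. finprod G (\<lambda>x. x [^]\<^bsub>G\<^esub> c x) S = \<one>\<^bsub>G\<^esub> \<longrightarrow> (\<forall>x \<in> S. c x = 0))"

definition finite_rank :: "('a, 'b) monoid_scheme \<Rightarrow> bool"
  where "finite_rank G \<longleftrightarrow> (\<exists>n. \<forall>S. int_independent G S \<longrightarrow> card S \<le> n)"

text \<open>Meaningful only under \<^const>\<open>finite_rank\<close>.\<close>

definition group_rank :: "('a, 'b) monoid_scheme \<Rightarrow> nat"
  where "group_rank G = Max (card ` {S. int_independent G S})"

definition tffr_group :: "('a, 'b) monoid_scheme \<Rightarrow> bool"
  where "tffr_group G \<longleftrightarrow> comm_group G \<and> torsion_free_group G \<and> finite_rank G"

definition rank_one_group :: "('a, 'b) monoid_scheme \<Rightarrow> bool"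
  where "rank_one_group G \<longleftrightarrow> tffr_group G \<and> group_rank G = 1"

text \<open>Internal direct sums; in finite rank only finitely many nonzero summands can occur.\<close>

definition direct_decomposition ::
    "('a, 'b) monoid_scheme \<Rightarrow> 'i set \<Rightarrow> ('i \<Rightarrow> 'a set) \<Rightarrow> bool"
  where "direct_decomposition G I B \<longleftrightarrow> finite I \<and> (\<forall>i \<in> I. subgroup (B i) G) \<and>
    (\<lambda>x. finprod G x I) \<in> iso (product_group I (\<lambda>i. G\<lparr>carrier := B i\<rparr>)) G"

definition indecomposable_group :: "('a, 'b) monoid_scheme \<Rightarrow> bool"
  where "indecomposable_group G \<longleftrightarrow> carrier G \<noteq> {\<one>\<^bsub>G\<^esub>} \<and>
    (\<forall>B. direct_decomposition G {1, 2::nat} B \<longrightarrow> B 1 = {\<one>\<^bsub>G\<^esub>} \<or> B 2 = {\<one>\<^bsub>G\<^esub>})"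

definition indecomposable_decomposition ::
    "('a, 'b) monoid_scheme \<Rightarrow> nat \<Rightarrow> (nat \<Rightarrow> 'a set) \<Rightarrow> bool"
  where "indecomposable_decomposition G s B \<longleftrightarrow> direct_decomposition G {1..s} B \<and>
    (\<forall>i \<in> {1..s}. indecomposable_group (G\<lparr>carrier := B i\<rparr>))"

definition realizes_partition :: "('a, 'b) monoid_scheme \<Rightarrow> nat multiset \<Rightarrow> bool"
  where "realizes_partition G P \<longleftrightarrow> (\<exists>s B. indecomposable_decomposition G s B \<and>
    P = image_mset (\<lambda>i. group_rank (G\<lparr>carrier := B i\<rparr>)) (mset_set {1..s}))"

definition rat_group :: "rat monoid"
  where "rat_group = \<lparr>carrier = UNIV, monoid.mult = (+), one = 0\<rparr>"

text \<open>
  Every torsion-free group of rank one is isomorphic to a subgroup of the rationals.  Its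
  isomorphism class (type) is therefore represented by the set of all subgroups of the rationals
  that are isomorphic to it, which makes types of groups over different carriers comparable.
\<close>

type_synonym group_type = "rat set set"

definition type_of_group :: "('a, 'b) monoid_scheme \<Rightarrow> group_type"
  where "type_of_group G = {S. subgroup S rat_group \<and> G \<cong> rat_group\<lparr>carrier := S\<rparr>}"

definition type_le :: "group_type \<Rightarrow> group_type \<Rightarrow> bool"
  where "type_le \<sigma> \<tau> \<longleftrightarrow> (\<exists>S \<in> \<sigma>. \<exists>T \<in> \<tau>.
    \<exists>h \<in> hom (rat_group\<lparr>carrier := S\<rparr>) (rat_group\<lparr>carrier := T\<rparr>). \<exists>x \<in> S. h x \<noteq> 0)"

definition completely_decomposable :: "('a, 'b) monoid_scheme \<Rightarrow> bool"
  where "completely_decomposable G \<longleftrightarrow> (\<exists>(n::nat) B. direct_decomposition G {1..n} B \<and>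
    (\<forall>i \<in> {1..n}. rank_one_group (G\<lparr>carrier := B i\<rparr>)))"

definition homogeneous_of_type :: "group_type \<Rightarrow> ('a, 'b) monoid_scheme \<Rightarrow> bool"
  where "homogeneous_of_type \<rho> G \<longleftrightarrow> (\<exists>(n::nat) B. direct_decomposition G {1..n} B \<and>
    (\<forall>i \<in> {1..n}. rank_one_group (G\<lparr>carrier := B i\<rparr>) \<and> type_of_group (G\<lparr>carrier := B i\<rparr>) = \<rho>))"

definition homogeneous_decomposition ::
    "('a, 'b) monoid_scheme \<Rightarrow> group_type set \<Rightarrow> (group_type \<Rightarrow> 'a set) \<Rightarrow> bool"
  where "homogeneous_decomposition A T B \<longleftrightarrow> direct_decomposition A T B \<and>
    (\<forall>\<rho> \<in> T. B \<rho> \<noteq> {\<one>\<^bsub>A\<^esub>} \<and> homogeneous_of_type \<rho> (A\<lparr>carrier := B \<rho>\<rparr>))"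

text \<open>
  All homogeneous decompositions of a completely decomposable group have the same index set
  (Baer), so taking the types occurring in some homogeneous decomposition involves no choice.
\<close>

definition critical_types :: "('a, 'b) monoid_scheme \<Rightarrow> group_type set"
  where "critical_types A = {\<rho>. \<exists>T B. homogeneous_decomposition A T B \<and> \<rho> \<in> T}"

text \<open>Finiteness of the index is explicit because \<^const>\<open>card\<close> is 0 on infinite sets.\<close>

definition cd_finite_index :: "('a, 'b) monoid_scheme \<Rightarrow> 'a set \<Rightarrow> bool"
  where "cd_finite_index G A \<longleftrightarrow> subgroup A G \<and> finite (rcosets\<^bsub>G\<^esub> A) \<and>
    completely_decomposable (G\<lparr>carrier := A\<rparr>)"

definition almost_completely_decomposable :: "('a, 'b) monoid_scheme \<Rightarrow> bool"
  where "almost_completely_decomposable G \<longleftrightarrow> tffr_group G \<and> (\<exists>A. cd_finite_index G A)"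

definition regulating_subgroup :: "('a, 'b) monoid_scheme \<Rightarrow> 'a set \<Rightarrow> bool"
  where "regulating_subgroup G A \<longleftrightarrow> cd_finite_index G A \<and>
    (\<forall>B. cd_finite_index G B \<longrightarrow> card (rcosets\<^bsub>G\<^esub> A) \<le> card (rcosets\<^bsub>G\<^esub> B))"

definition regulator :: "('a, 'b) monoid_scheme \<Rightarrow> 'a set"
  where "regulator G = \<Inter> {A. regulating_subgroup G A}"

definition regulator_types :: "('a, 'b) monoid_scheme \<Rightarrow> group_type set"
  where "regulator_types G = critical_types (G\<lparr>carrier := regulator G\<rparr>)"

definition block_rigid :: "('a, 'b) monoid_scheme \<Rightarrow> bool"
  where "block_rigid G \<longleftrightarrow>
    (\<forall>\<sigma> \<in> regulator_types G. \<forall>\<tau> \<in> regulator_types G. type_le \<sigma> \<tau> \<longrightarrow> \<sigma> = \<tau>)"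

definition class_B :: "('a, 'b) monoid_scheme \<Rightarrow> bool"
  where "class_B G \<longleftrightarrow> almost_completely_decomposable G \<and> block_rigid G \<and>
    cyclic_group (G Mod regulator G)"

end

theory Submission
  imports Defs "HOL-Library.Function_Algebras" "HOL-Algebra.Multiplicative_Group"
begin

text \<open>
  Coordinates with respect to the rank-one summands of the regulator embed \<open>X\<close> into a rational
  vector space.  Since the critical types form an antichain, every endomorphism of \<open>X\<close>
  preserves the purification \<open>X \<inter> V\<^sub>\<tau>\<close> of each block \<open>R\<^sub>\<tau>\<close>, so it suffices
  to show that an indecomposable summand \<open>\<pi> X\<close> meets it in rank at most one.  If \<open>x\<^sub>0\<close>
  generates \<open>X\<close> modulo the regulator, then \<open>\<pi> X\<close> is generated by \<open>\<pi> x\<^sub>0\<close> and elements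
  lying in single blocks.  In a homogeneous block a pure rank-one subgroup is a summand; splitting
  off the one that contains the \<open>\<tau>\<close>-component of \<open>\<pi> x\<^sub>0\<close> leaves \<open>\<pi> x\<^sub>0\<close> fixed, hence
  the complement in the \<open>\<tau>\<close>-block is a direct summand of \<open>\<pi> X\<close> and must vanish.
  The purified block is itself homogeneous completely decomposable, being a cyclic extension of
  \<open>R\<^sub>\<tau>\<close> and \<open>S + \<int>q\<close> being a multiple of \<open>S\<close> for rank-one \<open>S\<close>.
\<close>

section \<open>Subgroups of rational vector spaces\<close>

text \<open>The obstacle is that \<open>X\<close> is not the sum of its blocks: a map assembled
  block by block need not respect the element \<open>x0\<close> that glues them. A map fixing
  \<open>\<pi> x0\<close> respects it trivially, which dictates the line to split off. This is where
  cyclicity of the quotient enters: several generators would have several \<tau>-components, in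
  general not on one line. The blocks are purified because the invariance of
  \<open>X \<inter> V\<^sub>\<tau>\<close> under an endomorphism needs only a positive
  \<open>m\<close> with \<open>m X\<close> inside the regulator: the claim is checked on
  \<open>m v\<close>, then \<open>m\<close> is cancelled. The price is that the homogeneity of the
  larger block has to be established, by an explicit change of coordinates. Rank is bounded through
  functionals. Each of the \<open>s\<close> projections yields one rational functional that detects
  its image of the \<tau>-block, and together they are injective on
  \<open>R\<^sub>\<tau>\<close>.\<close>

definition diff_closed :: "'a::ab_group_add set \<Rightarrow> bool"
  where "diff_closed A \<longleftrightarrow> 0 \<in> A \<and> (\<forall>x\<in>A. \<forall>y\<in>A. x - y \<in> A)"

definition smul :: "rat \<Rightarrow> ('j \<Rightarrow> rat) \<Rightarrow> 'j \<Rightarrow> rat"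
  where "smul c v = (\<lambda>j. c * v j)"

lemma smul_apply [simp]: "smul c v j = c * v j"
  by (simp add: smul_def)

lemma smul_zero: "smul 0 v = 0"
  and smul_one: "smul 1 v = v"
  by (simp_all add: fun_eq_iff)

lemma diff_closedD:
  assumes "diff_closed A"
  shows diff_closed_zero: "0 \<in> A"
    and diff_closed_diff: "x \<in> A \<Longrightarrow> y \<in> A \<Longrightarrow> x - y \<in> A"
    and diff_closed_uminus: "x \<in> A \<Longrightarrow> - x \<in> A"
    and diff_closed_add: "x \<in> A \<Longrightarrow> y \<in> A \<Longrightarrow> x + y \<in> A"
proof -
  show "0 \<in> A" and diff: "\<And>x y. x \<in> A \<Longrightarrow> y \<in> A \<Longrightarrow> x - y \<in> A"
    using assms by (auto simp: diff_closed_def)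
  then have neg: "\<And>x. x \<in> A \<Longrightarrow> - x \<in> A"
    using diff [of 0] by auto
  then show "x \<in> A \<Longrightarrow> - x \<in> A" .
  show "x \<in> A \<Longrightarrow> y \<in> A \<Longrightarrow> x + y \<in> A"
    using diff [of x "- y"] neg by auto
qed

text \<open>Integer multiples are needed for rationals, vectors and integers alike; an additive
  function of the multiplier covers all three.\<close>

lemma diff_closed_int_rec:
  fixes f :: "int \<Rightarrow> 'a::ab_group_add"
  assumes "diff_closed A" and "f 0 = 0" and "\<And>k l. f (k + l) = f k + f l" and "f 1 \<in> A"
  shows "f k \<in> A"
proof (induction k rule: int_induct [where k = 0])
  case base
  then show ?case using assms diff_closed_zero by metis
next
  case (step1 i)
  then show ?case using assms diff_closed_add by metis
next
  case (step2 i)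
  have "f i = f (i - 1) + f 1"
    using assms(3) [of "i - 1" 1] by simp
  then have "f (i - 1) = f i - f 1" by (simp add: algebra_simps)
  then show ?case using assms(1,4) step2 diff_closed_diff by metis
qed

lemma diff_closed_of_int_mult:
  fixes x :: rat
  assumes "diff_closed A" and "x \<in> A"
  shows "of_int k * x \<in> A"
  by (rule diff_closed_int_rec) (use assms in \<open>auto simp: algebra_simps\<close>)

lemma diff_closed_smul:
  assumes "diff_closed A" and "v \<in> A"
  shows "smul (of_int k) v \<in> A"
  by (rule diff_closed_int_rec) (use assms in \<open>auto simp: algebra_simps fun_eq_iff smul_def\<close>)

lemma diff_closed_sum:
  assumes "diff_closed A" and "\<And>i. i \<in> I \<Longrightarrow> f i \<in> A"
  shows "sum f I \<in> A"
  using assms(2)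
  by (induction I rule: infinite_finite_induct)
    (auto intro: diff_closed_zero [OF assms(1)] diff_closed_add [OF assms(1)])

section \<open>Finitely generated subgroups of the rationals are cyclic\<close>

lemma rat_pair_common_divisor:
  fixes x y :: rat
  shows "\<exists>(k::int) l a b. x = (of_int a * x + of_int b * y) * of_int k \<and>
    y = (of_int a * x + of_int b * y) * of_int l"
proof -
  obtain n1 d1 where x: "x = of_int n1 / of_int d1" "d1 > 0"
    by (metis quotient_of_div quotient_of_denom_pos surj_pair)
  obtain n2 d2 where y: "y = of_int n2 / of_int d2" "d2 > 0"
    by (metis quotient_of_div quotient_of_denom_pos surj_pair)
  \<comment> \<open>Over the common denominator \<open>d1 * d2\<close> these are the numerators, and
    their gcd gives the generator.\<close>
  let ?X = "n1 * d2" and ?Y = "n2 * d1"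
  obtain a b where ab: "a * ?X + b * ?Y = gcd ?X ?Y"
    using bezout_int by blast
  obtain k l where k: "?X = gcd ?X ?Y * k" and l: "?Y = gcd ?X ?Y * l"
    using gcd_dvd1 gcd_dvd2 by (meson dvdE)
  have X: "x = of_int ?X / of_int (d1 * d2)" and Y: "y = of_int ?Y / of_int (d1 * d2)"
    using x y by auto
  have g: "of_int a * x + of_int b * y = of_int (gcd ?X ?Y) / of_int (d1 * d2)"
    unfolding X Y ab [symmetric] by (simp add: add_divide_distrib)
  have "x = (of_int a * x + of_int b * y) * of_int k"
    unfolding g by (subst X, subst k) simp
  moreover have "y = (of_int a * x + of_int b * y) * of_int l"
    unfolding g by (subst Y, subst l) simp
  ultimately show ?thesis by blast
qed

text \<open>The generator is exhibited as an integer combination of the family, so that it lies in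
  every subgroup containing the family. The induction merges it with one further rational.\<close>

lemma rat_family_common_divisor:
  fixes v :: "'j \<Rightarrow> rat"
  assumes "finite J"
  shows "\<exists>c a :: 'j \<Rightarrow> int. \<forall>j\<in>J. v j = (\<Sum>i\<in>J. of_int (a i) * v i) * of_int (c j)"
  using assms
proof (induction J)
  case empty
  show ?case by simp
next
  case (insert x J)
  then obtain c a :: "'j \<Rightarrow> int"
    where ca: "\<forall>j\<in>J. v j = (\<Sum>i\<in>J. of_int (a i) * v i) * of_int (c j)" by blast
  define q where "q = (\<Sum>i\<in>J. of_int (a i) * v i)"
  obtain k l \<alpha> \<beta> :: int where kl: "q = (of_int \<alpha> * q + of_int \<beta> * v x) * of_int k"
    "v x = (of_int \<alpha> * q + of_int \<beta> * v x) * of_int l"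
    using rat_pair_common_divisor by blast
  define a' where "a' = (\<lambda>i. \<alpha> * a i)(x := \<beta>)"
  define c' where "c' = (\<lambda>i. k * c i)(x := l)"
  have "(\<Sum>i\<in>J. of_int (a' i) * v i) = of_int \<alpha> * q"
    unfolding q_def sum_distrib_left using insert(2) by (intro sum.cong) (auto simp: a'_def)
  then have s: "(\<Sum>i\<in>insert x J. of_int (a' i) * v i) = of_int \<alpha> * q + of_int \<beta> * v x"
    using insert(1,2) by (simp add: a'_def)
  have "v j = (\<Sum>i\<in>insert x J. of_int (a' i) * v i) * of_int (c' j)" if "j \<in> insert x J" for j
  proof (cases "j = x")
    case True
    then show ?thesis using kl(2) unfolding s by (simp add: c'_def)
  next
    case False
    then have "v j = q * of_int (c j)" using ca that by (simp add: q_def)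
    also have "\<dots> = (of_int \<alpha> * q + of_int \<beta> * v x) * of_int k * of_int (c j)"
      by (subst kl(1)) simp
    finally show ?thesis using False unfolding s by (simp add: c'_def)
  qed
  then show ?case by blast
qed

text \<open>The integer vector \<open>c\<close> is a unimodular direction of \<open>v\<close>,
  certified by \<open>a\<close>: the functional with coefficients \<open>a\<close> takes the value
  \<open>q\<close> on \<open>v\<close>. Being integral, this functional maps vectors with entries in
  a subgroup into that subgroup.\<close>

lemma rat_family_primitive:
  fixes v :: "'j \<Rightarrow> rat"
  assumes "finite J" and "J \<noteq> {}"
  obtains q and c a :: "'j \<Rightarrow> int"
  where "\<And>j. j \<in> J \<Longrightarrow> v j = q * of_int (c j)" and "(\<Sum>j\<in>J. a j * c j) = 1"
proof (cases "\<forall>j\<in>J. v j = 0")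
  case True
  \<comment> \<open>The zero family determines no direction, so a unit vector stands in for
    \<open>c\<close>, with \<open>q = 0\<close>; this is where \<open>J\<close> must be
    nonempty.\<close>
  obtain x where x: "x \<in> J" using assms by blast
  have "(\<Sum>j\<in>J. (if j = x then 1 else 0) * (if j = x then 1 else 0 :: int)) = (\<Sum>j\<in>J. if j = x then 1 else 0)"
    by (intro sum.cong) auto
  also have "\<dots> = 1" using assms(1) x by simp
  finally show ?thesis
    using True that [of 0 "\<lambda>j. if j = x then 1 else 0" "\<lambda>j. if j = x then 1 else 0"] by auto
next
  case False
  obtain c a :: "'j \<Rightarrow> int"
    where ca: "\<forall>j\<in>J. v j = (\<Sum>i\<in>J. of_int (a i) * v i) * of_int (c j)"
    using rat_family_common_divisor [OF assms(1)] by blast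
  define q where "q = (\<Sum>i\<in>J. of_int (a i) * v i)"
  have v: "v j = q * of_int (c j)" if "j \<in> J" for j
    using ca that by (simp add: q_def)
  have "q \<noteq> 0" using False v by auto
  have "q = (\<Sum>i\<in>J. of_int (a i) * (q * of_int (c i)))"
    unfolding q_def using v by (intro sum.cong) (auto simp: q_def)
  also have "\<dots> = q * of_int (\<Sum>j\<in>J. a j * c j)"
    by (simp add: sum_distrib_left algebra_simps)
  finally have "of_int (\<Sum>j\<in>J. a j * c j) = (1::rat)"
    using \<open>q \<noteq> 0\<close> by (metis mult_cancel_left2)
  then have "(\<Sum>j\<in>J. a j * c j) = 1" by linarith
  then show ?thesis using that v by blast
qed

text \<open>For the least positive \<open>d\<close> with \<open>d q\<close> in \<open>S\<close>, the
  group \<open>S + \<int> q\<close> equals \<open>S / d\<close>: one inclusion is the choice of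
  \<open>d\<close>, the other is the last conclusion. Hence adjoining \<open>q\<close> does not
  change the type.\<close>

lemma rat_overgroup_scaled:
  fixes S :: "rat set"
  assumes S: "diff_closed S" and "0 < m" and "of_int m * q \<in> S"
  obtains d :: int where "0 < d" and "of_int d * q \<in> S"
    and "\<And>s. s \<in> S \<Longrightarrow> \<exists>t\<in>S. \<exists>k::int. s / of_int d = t + of_int k * q"
proof -
  define P where "P = (\<lambda>n::nat. 0 < n \<and> of_int (int n) * q \<in> S)"
  have "P (nat m)" using assms by (simp add: P_def)
  then have PL: "P (LEAST n. P n)" by (rule LeastI)
  define n where "n = (LEAST n. P n)"
  define d where "d = int n"
  have d: "0 < d" "of_int d * q \<in> S" using PL by (auto simp: P_def d_def n_def)
  have "\<exists>t\<in>S. \<exists>k::int. s / of_int d = t + of_int k * q" if s: "s \<in> S" for s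
  proof -
    define r where "r = of_int d * q"
    obtain \<alpha> \<beta> a b :: int where *: "r = (of_int a * r + of_int b * s) * of_int \<alpha>"
      "s = (of_int a * r + of_int b * s) * of_int \<beta>"
      using rat_pair_common_divisor by blast
    define g where "g = of_int a * r + of_int b * s"
    have "r \<in> S" using d by (simp add: r_def)
    then have g: "g \<in> S" unfolding g_def
      using S s by (intro diff_closed_add diff_closed_of_int_mult) auto
    have r: "r = g * of_int \<alpha>" and s': "s = g * of_int \<beta>" using * by (simp_all add: g_def)
    \<comment> \<open>A common factor could be cancelled in \<open>d q = \<alpha> g\<close>, against
      the minimality of \<open>d\<close>.\<close>
    have "coprime \<alpha> d"
    proof -
      obtain e where e: "d = gcd \<alpha> d * e" using gcd_dvd2 dvdE by blast
      obtain f where f: "\<alpha> = gcd \<alpha> d * f" using gcd_dvd1 dvdE by blast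
      have gp: "gcd \<alpha> d > 0" using d by simp
      then have ep: "e > 0" using e d by (metis zero_less_mult_pos)
      have "of_int (gcd \<alpha> d) * (of_int e * q) = of_int (gcd \<alpha> d) * (of_int f * g)"
        using r unfolding r_def by (subst (asm) e, subst (asm) f) (simp add: algebra_simps)
      then have "of_int e * q = of_int f * g" using gp by auto
      then have "of_int e * q \<in> S" using diff_closed_of_int_mult [OF S g] by simp
      then have "P (nat e)" using ep by (simp add: P_def)
      then have "n \<le> nat e" unfolding n_def by (rule Least_le)
      then have "d \<le> e" using ep by (simp add: d_def)
      then have "gcd \<alpha> d * e \<le> 1 * e" by (simp add: e [symmetric])
      then have "gcd \<alpha> d \<le> 1" using ep by (rule mult_right_le_imp_le)
      then have "gcd \<alpha> d = 1" using gp by linarith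
      then show ?thesis by (simp add: coprime_iff_gcd_eq_1)
    qed
    then obtain x y where xy: "x * \<alpha> + y * d = 1"
      using bezout_int [of \<alpha> d] by (auto simp: coprime_iff_gcd_eq_1)
    \<comment> \<open>Both \<open>\<alpha> s\<close> and \<open>\<beta> r\<close> equal
      \<open>\<alpha> \<beta> g\<close>, and \<open>r = d q\<close>, so division by \<open>d\<close>
      is possible in both terms.\<close>
    have "s = of_int (x * \<alpha> + y * d) * s" by (simp add: xy)
    also have "\<dots> = of_int (x * \<beta>) * r + of_int (y * d) * s"
      using r s' by (simp add: algebra_simps)
    finally have "s / of_int d = of_int y * s + of_int (x * \<beta>) * q"
      using d by (simp add: r_def field_simps)
    moreover have "of_int y * s \<in> S" using diff_closed_of_int_mult [OF S s] .
    ultimately show ?thesis by blast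
  qed
  then show ?thesis using that d by blast
qed

text \<open>The product of the \<open>S j\<close>. Entries outside \<open>J\<close> are 0 and not
  undefined, so that the pointwise operations of the function type apply.\<close>

definition box :: "'j set \<Rightarrow> ('j \<Rightarrow> rat set) \<Rightarrow> ('j \<Rightarrow> rat) set"
  where "box J S = {v. (\<forall>j\<in>J. v j \<in> S j) \<and> (\<forall>j. j \<notin> J \<longrightarrow> v j = 0)}"

lemma diff_closed_box:
  assumes "\<And>j. j \<in> J \<Longrightarrow> diff_closed (S j)"
  shows "diff_closed (box J S)"
  using assms by (auto simp: diff_closed_def box_def)

text \<open>The map \<open>v \<mapsto> f v u\<close> projects \<open>H\<close> onto its pure
  rank-one subgroup through \<open>u\<close>, so that subgroup is a direct summand. Here
  \<open>H\<close> is a homogeneous box extended by one element \<open>h = q C\<close> with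
  \<open>C\<close> unimodular; it grows only along \<open>C\<close>, from \<open>S\<close> to
  \<open>S + \<int> q\<close>, which is \<open>S / d\<close>. In coordinates adapted to
  \<open>C\<close> the group is homogeneous again, and an integral functional adapted to
  \<open>u\<close> gives \<open>f\<close>.\<close>

lemma box_retraction:
  fixes S :: "rat set" and J :: "'j set"
  assumes J: "finite J" and S: "diff_closed S" and H: "diff_closed H"
    and supp: "\<And>v j. v \<in> H \<Longrightarrow> j \<notin> J \<Longrightarrow> v j = 0"
    and boxH: "box J (\<lambda>_. S) \<subseteq> H"
    and h: "h \<in> H" "0 < m" "smul (of_int m) h \<in> box J (\<lambda>_. S)"
    and gen: "\<And>v. v \<in> H \<Longrightarrow> \<exists>k::int. v - smul (of_int k) h \<in> box J (\<lambda>_. S)"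
    and u: "u \<in> H" "u \<noteq> 0"
  obtains f :: "('j \<Rightarrow> rat) \<Rightarrow> rat"
  where "\<And>v w. f (v + w) = f v + f w" and "\<And>c v. f (smul c v) = c * f v" and "f u = 1"
    and "\<And>v. v \<in> H \<Longrightarrow> smul (f v) u \<in> H"
proof -
  have "J \<noteq> {}" using supp [OF u(1)] u(2) by (auto simp: fun_eq_iff)
  then obtain q and c a :: "'j \<Rightarrow> int" where hq: "\<And>j. j \<in> J \<Longrightarrow> h j = q * of_int (c j)"
    and ac: "(\<Sum>j\<in>J. a j * c j) = 1"
    using rat_family_primitive [OF J, of h] by blast
  \<comment> \<open>The integral functional dual to the direction of \<open>h\<close>: it sends
    \<open>h\<close> to \<open>q\<close> and the box into \<open>S\<close>.\<close>
  define A where "A = (\<lambda>v. \<Sum>j\<in>J. of_int (a j) * v j :: rat)"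
  have A_add: "A (v + w) = A v + A w" and A_smul: "A (smul r v) = r * A v" for v w r
    by (simp_all add: A_def sum.distrib sum_distrib_left algebra_simps)
  have Ah: "A h = q"
  proof -
    have "A h = (\<Sum>j\<in>J. q * of_int (a j * c j))"
      unfolding A_def by (intro sum.cong) (auto simp: hq)
    also have "\<dots> = q * of_int (\<Sum>j\<in>J. a j * c j)" by (simp add: sum_distrib_left)
    finally show ?thesis using ac by simp
  qed
  have A_box: "A w \<in> S" if "w \<in> box J (\<lambda>_. S)" for w
    unfolding A_def using that S
    by (intro diff_closed_sum diff_closed_of_int_mult) (auto simp: box_def)
  have "of_int m * q \<in> S" using A_box [OF h(3)] by (simp add: A_smul Ah)
  then obtain d :: int where d: "0 < d" "of_int d * q \<in> S"
    and dS: "\<And>s. s \<in> S \<Longrightarrow> \<exists>t\<in>S. \<exists>k::int. s / of_int d = t + of_int k * q"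
    using rat_overgroup_scaled [OF S h(2)] by blast
  define C where "C = (\<lambda>j. if j \<in> J then of_int (c j) else 0 :: rat)"
  have hC: "h = smul q C"
    using hq supp [OF h(1)] by (auto simp: fun_eq_iff C_def)
  have boxC: "smul s C \<in> box J (\<lambda>_. S)" if "s \<in> S" for s
    using diff_closed_of_int_mult [OF S that] by (auto simp: box_def C_def mult.commute)
  \<comment> \<open>The line of \<open>C\<close> in \<open>H\<close> contains all of
    \<open>S / d\<close>: an element of \<open>S\<close> gives a box vector along \<open>C\<close>,
    and a multiple of \<open>q\<close> gives a multiple of \<open>h\<close>.\<close>
  have CH: "smul (s / of_int d) C \<in> H" if "s \<in> S" for s
  proof -
    obtain t k where t: "t \<in> S" "s / of_int d = t + of_int k * q" using dS [OF \<open>s \<in> S\<close>] by blast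
    have "smul (s / of_int d) C = smul t C + smul (of_int k) h"
      unfolding t(2) hC by (simp add: fun_eq_iff algebra_simps)
    then show ?thesis
      using boxC [OF t(1)] boxH diff_closed_smul [OF H h(1)] diff_closed_add [OF H] by fastforce
  qed
  \<comment> \<open>New coordinates with values in \<open>S\<close>: \<open>None\<close> is the
    component along \<open>C\<close>, rescaled by \<open>d\<close>, and \<open>Some j\<close> are
    the entries of the remainder, which \<open>A\<close> kills. There is one coordinate too many;
    all that matters is that they lie in \<open>S\<close> and determine the vector.\<close>
  define g where "g = (\<lambda>v k. case k of None \<Rightarrow> of_int d * A v | Some j \<Rightarrow> v j - A v * C j)"
  define K where "K = insert None (Some ` J)"
  have gS: "g v k \<in> S" if v: "v \<in> H" and k: "k \<in> K" for v k
  proof -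
    obtain l :: int where l: "v - smul (of_int l) h \<in> box J (\<lambda>_. S)" using gen [OF v] by blast
    define w where "w = v - smul (of_int l) h"
    have w: "w \<in> box J (\<lambda>_. S)" and vw: "v = w + smul (of_int l) h"
      using l by (auto simp: w_def)
    have Av: "A v = A w + of_int l * q" by (simp add: vw A_add A_smul Ah)
    show ?thesis
    proof (cases k)
      case None
      have "g v k = of_int d * A w + of_int l * (of_int d * q)"
        using None by (simp add: g_def Av algebra_simps)
      then show ?thesis
        using diff_closed_add [OF S] diff_closed_of_int_mult [OF S] A_box [OF w] d(2) by metis
    next
      case (Some j)
      then have j: "j \<in> J" using k by (auto simp: K_def)
      \<comment> \<open>The multiple of \<open>h\<close> drops out, since \<open>h = q C\<close> and
        \<open>A h = q\<close>.\<close>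
      have "g v k = w j - of_int (c j) * A w"
        using Some j by (simp add: g_def Av) (simp add: vw hC C_def algebra_simps)
      then show ?thesis
        using diff_closed_diff [OF S] diff_closed_of_int_mult [OF S] A_box [OF w] w j
        by (simp add: box_def)
    qed
  qed
  have g_add: "g (v + w) k = g v k + g w k" and g_smul: "g (smul r v) k = r * g v k" for v w k r
    by (simp_all add: g_def A_add A_smul algebra_simps split: option.split)
  have finK: "finite K" "K \<noteq> {}" using J by (auto simp: K_def)
  obtain q' and c' a' :: "'j option \<Rightarrow> int" where gq: "\<And>k. k \<in> K \<Longrightarrow> g u k = q' * of_int (c' k)"
    and ac': "(\<Sum>k\<in>K. a' k * c' k) = 1"
    using rat_family_primitive [OF finK, of "g u"] by blast
  define F where "F = (\<lambda>v. \<Sum>k\<in>K. of_int (a' k) * g v k)"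
  have F_add: "F (v + w) = F v + F w" and F_smul: "F (smul r v) = r * F v" for v w r
    by (simp_all add: F_def g_add g_smul sum.distrib sum_distrib_left algebra_simps)
  have Fu: "F u = q'"
  proof -
    have "F u = (\<Sum>k\<in>K. q' * of_int (a' k * c' k))"
      unfolding F_def by (intro sum.cong) (auto simp: gq)
    also have "\<dots> = q' * of_int (\<Sum>k\<in>K. a' k * c' k)" by (simp add: sum_distrib_left)
    finally show ?thesis using ac' by simp
  qed
  have FS: "F v \<in> S" if "v \<in> H" for v
    unfolding F_def using S gS that by (intro diff_closed_sum diff_closed_of_int_mult) auto
  have uN: "of_int d * A u = q' * of_int (c' None)"
    using gq [of None] by (simp add: g_def K_def)
  have uS: "u j = A u * C j + q' * of_int (c' (Some j))" if "j \<in> J" for j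
    using gq [of "Some j"] that by (simp add: g_def K_def)
  have "q' \<noteq> 0"
  proof
    assume "q' = 0"
    then have "A u = 0" using uN d(1) by simp
    then have "u = 0" using uS \<open>q' = 0\<close> supp [OF u(1)] by (force simp: fun_eq_iff)
    then show False using u(2) by simp
  qed
  define f where "f = (\<lambda>v. F v / q')"
  show thesis
  proof (rule that [of f])
    show "f (v + w) = f v + f w" and "f (smul r v) = r * f v" for v w r
      by (simp_all add: f_def F_add F_smul add_divide_distrib)
    show "f u = 1" using \<open>q' \<noteq> 0\<close> by (simp add: f_def Fu)
    show "smul (f v) u \<in> H" if v: "v \<in> H" for v
    proof -
      define s where "s = F v"
      have s: "s \<in> S" using FS [OF v] by (simp add: s_def)
      define w where "w = (\<lambda>j. if j \<in> J then of_int (c' (Some j)) * s else 0)"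
      have w: "w \<in> box J (\<lambda>_. S)"
        using diff_closed_of_int_mult [OF S s] by (auto simp: w_def box_def)
      have Au: "A u = q' * of_int (c' None) / of_int d" using uN d(1) by (simp add: field_simps)
      \<comment> \<open>This rebuilds the vector from the coordinates of \<open>u\<close>: since
        \<open>g u = q' c'\<close> and \<open>f v = s / q'\<close>, the factor \<open>q'\<close>
        cancels and only integer multiples of \<open>s\<close> remain.\<close>
      have "smul (f v) u = smul ((of_int (c' None) * s) / of_int d) C + w"
      proof (rule ext)
        fix j
        show "smul (f v) u j = (smul ((of_int (c' None) * s) / of_int d) C + w) j"
        proof (cases "j \<in> J")
          case True
          then show ?thesis using \<open>q' \<noteq> 0\<close> d(1)
            by (simp add: uS Au f_def s_def w_def field_simps)
        next
          case False
          then show ?thesis using supp [OF u(1)] by (simp add: w_def C_def)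
        qed
      qed
      then show ?thesis
        using CH [OF diff_closed_of_int_mult [OF S s]] w boxH diff_closed_add [OF H] by fastforce
    qed
  qed
qed

section \<open>Additive maps between subgroups, and subgroups of the integers\<close>

definition additive_on :: "'a::ab_group_add set \<Rightarrow> ('a \<Rightarrow> 'b::ab_group_add) \<Rightarrow> bool"
  where "additive_on A f \<longleftrightarrow> (\<forall>x\<in>A. \<forall>y\<in>A. f (x + y) = f x + f y)"

lemma additive_onD: "additive_on A f \<Longrightarrow> x \<in> A \<Longrightarrow> y \<in> A \<Longrightarrow> f (x + y) = f x + f y"
  by (simp add: additive_on_def)

lemma additive_on_zero:
  assumes "diff_closed A" and "additive_on A f"
  shows "f 0 = 0"
  using additive_onD [OF assms(2), of 0 0] diff_closed_zero [OF assms(1)] by simp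

lemma additive_on_diff:
  assumes "diff_closed A" and "additive_on A f" and "x \<in> A" and "y \<in> A"
  shows "f (x - y) = f x - f y"
  using additive_onD [OF assms(2), of "x - y" y] diff_closed_diff [OF assms(1)] assms(3,4) by simp

lemma additive_on_sum:
  assumes "diff_closed A" and "additive_on A f" and "finite I" and "\<And>i. i \<in> I \<Longrightarrow> x i \<in> A"
  shows "f (sum x I) = (\<Sum>i\<in>I. f (x i))"
  using assms(3,4)
proof (induction I)
  case empty
  show ?case using additive_on_zero [OF assms(1,2)] by simp
next
  case (insert a I)
  then show ?case
    using additive_onD [OF assms(2)] diff_closed_sum [OF assms(1), of I x] by simp
qed

lemma additive_on_smul:
  fixes f :: "('j \<Rightarrow> rat) \<Rightarrow> 'k \<Rightarrow> rat"
  assumes A: "diff_closed A" and f: "additive_on A f" and v: "v \<in> A"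
  shows "f (smul (of_int k) v) = smul (of_int k) (f v)"
proof -
  have m: "smul (of_int i) v \<in> A" for i using diff_closed_smul [OF A v] .
  have s: "smul (of_int (i + 1)) w = smul (of_int i) w + w"
    "smul (of_int (i - 1)) w = smul (of_int i) w - w" for i and w :: "'l \<Rightarrow> rat"
    by (simp_all add: fun_eq_iff algebra_simps)
  show ?thesis
  proof (induction k rule: int_induct [where k = 0])
    case base
    show ?case unfolding of_int_0 smul_zero by (rule additive_on_zero [OF A f])
  next
    case (step1 i)
    then show ?case by (simp only: s additive_onD [OF f m v])
  next
    case (step2 i)
    then show ?case by (simp only: s additive_on_diff [OF A f m v])
  qed
qed

text \<open>Multiplying by the denominator of \<open>r\<close> reduces the claim to integer
  multiples of \<open>u\<close>, and the ambient vectors have no torsion.\<close>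

lemma additive_on_fixed_smul:
  assumes A: "diff_closed A" and f: "additive_on A f" and u: "u \<in> A" "f u = u"
    and ru: "smul r u \<in> A"
  shows "f (smul r u) = smul r u"
proof -
  obtain n d where r: "r = of_int n / of_int d" "d > 0"
    by (metis quotient_of_div quotient_of_denom_pos surj_pair)
  have e: "smul (of_int d) (smul r u) = smul (of_int n) u"
    using r by (simp add: fun_eq_iff)
  have "smul (of_int d) (f (smul r u)) = smul (of_int d) (smul r u)"
    using additive_on_smul [OF A f ru, of d] additive_on_smul [OF A f u(1), of n] u(2)
    unfolding e by simp
  then show ?thesis using r(2) by (simp add: fun_eq_iff)
qed

lemma int_diff_closed_principal:
  fixes D :: "int set"
  assumes D: "diff_closed D"
  obtains d where "d \<in> D" and "\<And>k. k \<in> D \<Longrightarrow> d dvd k"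
proof (cases "\<exists>k\<in>D. k \<noteq> 0")
  case False
  then show ?thesis using that [of 0] diff_closed_zero [OF D] by auto
next
  case True
  have mult: "l * k \<in> D" if "k \<in> D" for k l
    by (rule diff_closed_int_rec [OF D, of "\<lambda>l. l * k"]) (use that in \<open>auto simp: algebra_simps\<close>)
  define P where "P = (\<lambda>n::nat. 0 < n \<and> int n \<in> D)"
  obtain k where k: "k \<in> D" "k \<noteq> 0" using True by blast
  have "\<bar>k\<bar> \<in> D" using k diff_closed_uminus [OF D] by (simp add: abs_if)
  then have "P (nat \<bar>k\<bar>)" using k by (simp add: P_def)
  then have PL: "P (LEAST n. P n)" by (rule LeastI)
  define d where "d = int (LEAST n. P n)"
  have d: "d \<in> D" "0 < d" using PL by (auto simp: P_def d_def)
  have "d dvd k" if k: "k \<in> D" for k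
  proof (rule ccontr)
    assume "\<not> d dvd k"
    then have pos: "0 < k mod d" using d(2)
      by (metis dvd_eq_mod_eq_0 pos_mod_sign order_le_less)
    have "k mod d = k - (k div d) * d" by (simp add: minus_div_mult_eq_mod)
    then have "k mod d \<in> D" using diff_closed_diff [OF D k mult [OF d(1)]] by simp
    then have "P (nat (k mod d))" using pos by (simp add: P_def)
    then have "(LEAST n. P n) \<le> nat (k mod d)" by (rule Least_le)
    then have "d \<le> k mod d" using pos by (simp add: d_def)
    then show False using d(2) pos_mod_bound [of d k] by linarith
  qed
  then show ?thesis using that d by blast
qed

definition part :: "('j \<Rightarrow> 't) \<Rightarrow> 't \<Rightarrow> ('j \<Rightarrow> rat) \<Rightarrow> 'j \<Rightarrow> rat"
  where "part t \<tau> v = (\<lambda>j. if t j = \<tau> then v j else 0)"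

definition unit_vec :: "'j \<Rightarrow> rat \<Rightarrow> 'j \<Rightarrow> rat"
  where "unit_vec j r = (\<lambda>i. if i = j then r else 0)"

lemma part_add: "part t \<tau> (v + w) = part t \<tau> v + part t \<tau> w"
  and part_diff: "part t \<tau> (v - w) = part t \<tau> v - part t \<tau> w"
  and part_smul: "part t \<tau> (smul r v) = smul r (part t \<tau> v)"
  and part_part: "part t \<tau> (part t \<tau> v) = part t \<tau> v"
  by (auto simp: part_def fun_eq_iff)

lemma smul_smul: "smul r (smul s v) = smul (r * s) v"
  and smul_add_left: "smul (r + s) v = smul r v + smul s v"
  by (auto simp: fun_eq_iff algebra_simps)

lemma sum_fun_apply: "(sum f I) j = (\<Sum>i\<in>I. f i j)" for f :: "'i \<Rightarrow> 'j \<Rightarrow> rat"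
  by (induction I rule: infinite_finite_induct) auto

section \<open>Indecomposable summands in coordinates\<close>

text \<open>Coordinate model of a block-rigid almost completely decomposable group \<open>X\<close> with cyclic
  regulator quotient: the coordinates \<open>j\<close> index the rank-one summands of the regulator, which
  becomes \<open>box J (S \<circ> t)\<close>, and \<open>t j\<close> is the type of the \<open>j\<close>-th summand.\<close>

locale cyclic_over_box =
  fixes J :: "'j set" and t :: "'j \<Rightarrow> 't" and S :: "'t \<Rightarrow> rat set"
    and X :: "('j \<Rightarrow> rat) set" and m :: int and x0 :: "'j \<Rightarrow> rat"
  assumes finJ: "finite J"
    and S: "\<And>j. j \<in> J \<Longrightarrow> diff_closed (S (t j))"
    and X: "diff_closed X"
    and supp: "\<And>x j. x \<in> X \<Longrightarrow> j \<notin> J \<Longrightarrow> x j = 0"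
    and box_X: "box J (S \<circ> t) \<subseteq> X"
    and m: "0 < m"
    and mX: "\<And>x. x \<in> X \<Longrightarrow> smul (of_int m) x \<in> box J (S \<circ> t)"
    and x0: "x0 \<in> X"
    and gen: "\<And>x. x \<in> X \<Longrightarrow> \<exists>k::int. x - smul (of_int k) x0 \<in> box J (S \<circ> t)"
    and antichain: "\<And>i j f r. \<lbrakk>i \<in> J; j \<in> J; t i \<noteq> t j; f ` S (t i) \<subseteq> S (t j);
      additive_on (S (t i)) f; r \<in> S (t i)\<rbrakk> \<Longrightarrow> f r = 0"
begin

abbreviation "bx \<equiv> box J (S \<circ> t)"

text \<open>The purification in \<open>X\<close> of the \<tau>-summand of the regulator. It may
  exceed that summand, which is \<open>bx \<inter> block \<tau>\<close>.\<close>

definition block :: "'t \<Rightarrow> ('j \<Rightarrow> rat) set"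
  where "block \<tau> = {x \<in> X. part t \<tau> x = x}"

lemma bx: "diff_closed bx"
  using S by (intro diff_closed_box) auto

lemma block_diff_closed: "diff_closed (block \<tau>)"
  using X by (auto simp: diff_closed_def block_def part_diff) (simp add: part_def fun_eq_iff)

lemma part_bx: "z \<in> bx \<Longrightarrow> part t \<tau> z \<in> bx"
  using S diff_closed_zero by (fastforce simp: box_def part_def)

lemma part_bx_block: "z \<in> bx \<Longrightarrow> part t \<tau> z \<in> block \<tau>"
  using part_bx box_X by (auto simp: block_def part_part)

lemma unit_vec_bx: "j \<in> J \<Longrightarrow> r \<in> S (t j) \<Longrightarrow> unit_vec j r \<in> bx"
  using S diff_closed_zero by (fastforce simp: box_def unit_vec_def)

lemma bx_sum: "z \<in> bx \<Longrightarrow> z = (\<Sum>j\<in>J. unit_vec j (z j))"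
  using finJ by (auto simp: fun_eq_iff sum_fun_apply unit_vec_def box_def)

text \<open>In the matrix of \<open>\<pi>\<close> with respect to the rank-one summands, entries
  between different types vanish by the antichain condition.\<close>

lemma endo_unit_vec:
  assumes \<pi>: "\<pi> ` X \<subseteq> X" "additive_on X \<pi>"
    and jk: "j \<in> J" "t j \<noteq> t k" and r: "r \<in> S (t j)"
  shows "\<pi> (unit_vec j r) k = 0"
proof (cases "k \<in> J")
  case False
  have "\<pi> (unit_vec j r) \<in> X" using unit_vec_bx [OF jk(1) r] box_X \<pi>(1) by blast
  then show ?thesis using False supp by blast
next
  case True
  \<comment> \<open>Values of \<open>\<pi>\<close> lie in \<open>X\<close> and not necessarily in
    the box; the factor \<open>m\<close> moves entry \<open>k\<close> into \<open>S (t k)\<close>,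
    which makes \<open>f\<close> a homomorphism between rank-one groups of different types.\<close>
  define f where "f = (\<lambda>r. of_int m * \<pi> (unit_vec j r) k)"
  have uX: "unit_vec j s \<in> X" if "s \<in> S (t j)" for s
    using unit_vec_bx [OF jk(1) that] box_X by blast
  have fS: "f s \<in> S (t k)" if "s \<in> S (t j)" for s
  proof -
    have "smul (of_int m) (\<pi> (unit_vec j s)) \<in> bx" using mX uX [OF that] \<pi>(1) by blast
    then show ?thesis using True by (auto simp: box_def f_def)
  qed
  have "f (s + s') = f s + f s'" if "s \<in> S (t j)" "s' \<in> S (t j)" for s s'
  proof -
    have "unit_vec j (s + s') = unit_vec j s + unit_vec j s'"
      by (simp add: unit_vec_def fun_eq_iff)
    then show ?thesis
      using additive_onD [OF \<pi>(2) uX [OF that(1)] uX [OF that(2)]]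
      by (simp add: f_def algebra_simps)
  qed
  then have "f r = 0"
    using fS r True jk by (intro antichain [of j k f]) (auto simp: additive_on_def)
  then show ?thesis using m by (simp add: f_def)
qed

text \<open>After expansion in unit vectors the two sides differ only in matrix entries between
  different types. The claim is confined to the box because the \<tau>-component of an element of
  \<open>X\<close> can lie outside \<open>X\<close>.\<close>

lemma endo_part:
  assumes \<pi>: "\<pi> ` X \<subseteq> X" "additive_on X \<pi>" and z: "z \<in> bx"
  shows "\<pi> (part t \<tau> z) = part t \<tau> (\<pi> z)"
proof -
  have expand: "\<pi> w k = (\<Sum>j\<in>J. \<pi> (unit_vec j (w j)) k)" if w: "w \<in> bx" for w k
  proof -
    have "unit_vec j (w j) \<in> X" if "j \<in> J" for j
      using w that unit_vec_bx [of j "w j"] box_X by (auto simp: box_def)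
    then have "\<pi> (\<Sum>j\<in>J. unit_vec j (w j)) = (\<Sum>j\<in>J. \<pi> (unit_vec j (w j)))"
      by (rule additive_on_sum [OF X \<pi>(2) finJ])
    then have "\<pi> w = (\<Sum>j\<in>J. \<pi> (unit_vec j (w j)))" by (simp only: bx_sum [OF w, symmetric])
    then show ?thesis by (simp only: sum_fun_apply)
  qed
  have \<pi>0: "\<pi> (unit_vec j 0) = 0" for j
    using additive_on_zero [OF X \<pi>(2)] by (simp add: unit_vec_def zero_fun_def)
  have zS: "z j \<in> S (t j)" if "j \<in> J" for j using z that by (auto simp: box_def)
  show ?thesis
  proof (rule ext)
    fix k
    show "\<pi> (part t \<tau> z) k = part t \<tau> (\<pi> z) k"
    proof (cases "t k = \<tau>")
      case True
      have "(\<Sum>j\<in>J. \<pi> (unit_vec j (part t \<tau> z j)) k) = (\<Sum>j\<in>J. \<pi> (unit_vec j (z j)) k)"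
        using True \<pi>0 endo_unit_vec [OF \<pi>] zS by (intro sum.cong) (auto simp: part_def)
      then show ?thesis using True expand [OF z] expand [OF part_bx [OF z]]
        by (simp add: part_def)
    next
      case False
      have "(\<Sum>j\<in>J. \<pi> (unit_vec j (part t \<tau> z j)) k) = 0"
        using False \<pi>0 endo_unit_vec [OF \<pi>] zS by (intro sum.neutral) (auto simp: part_def)
      then show ?thesis using False expand [OF part_bx [OF z]] by (simp add: part_def)
    qed
  qed
qed

text \<open>Commutation with the projection is available for \<open>m v\<close>, which lies in the
  box; the factor \<open>m\<close> is cancelled afterwards.\<close>

lemma endo_block:
  assumes \<pi>: "\<pi> ` X \<subseteq> X" "additive_on X \<pi>" and v: "v \<in> block \<tau>"
  shows "\<pi> v \<in> block \<tau>"
proof -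
  have vX: "v \<in> X" "part t \<tau> v = v" using v by (auto simp: block_def)
  have "smul (of_int m) (part t \<tau> (\<pi> v)) = part t \<tau> (\<pi> (smul (of_int m) v))"
    by (simp add: additive_on_smul [OF X \<pi>(2) vX(1)] part_smul)
  also have "\<dots> = \<pi> (part t \<tau> (smul (of_int m) v))"
    using endo_part [OF \<pi> mX [OF vX(1)]] by simp
  also have "\<dots> = smul (of_int m) (\<pi> v)"
    by (simp add: additive_on_smul [OF X \<pi>(2) vX(1)] part_smul vX(2))
  finally have "part t \<tau> (\<pi> v) = \<pi> v" using m by (simp add: fun_eq_iff)
  then show ?thesis using \<pi>(1) vX by (auto simp: block_def)
qed

lemma bx_block: "bx \<inter> block \<tau> = box {j \<in> J. t j = \<tau>} (\<lambda>_. S \<tau>)"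
proof -
  have "v \<in> bx \<inter> block \<tau>" if "v \<in> box {j \<in> J. t j = \<tau>} (\<lambda>_. S \<tau>)" for v
  proof -
    have "v \<in> bx" using that S diff_closed_zero by (fastforce simp: box_def)
    moreover have "part t \<tau> v = v" using that by (force simp: box_def part_def fun_eq_iff)
    ultimately show ?thesis using box_X by (auto simp: block_def)
  qed
  moreover have "v \<in> box {j \<in> J. t j = \<tau>} (\<lambda>_. S \<tau>)" if "v \<in> bx \<inter> block \<tau>" for v
    using that by (auto simp: box_def block_def part_def fun_eq_iff split: if_splits)
  ultimately show ?thesis by blast
qed

text \<open>The quotient of the block by its part in the box embeds into the cyclic quotient of
  \<open>X\<close>, and subgroups of cyclic groups are cyclic; \<open>D\<close> is the corresponding
  subgroup of the integers.\<close>

lemma block_generator: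
  obtains h where "h \<in> block \<tau>" and "\<And>v. v \<in> block \<tau> \<Longrightarrow> \<exists>k::int. v - smul (of_int k) h \<in> bx"
proof -
  define D where "D = {k::int. \<exists>v\<in>block \<tau>. v - smul (of_int k) x0 \<in> bx}"
  have "diff_closed D"
    unfolding diff_closed_def
  proof (intro conjI ballI)
    show "0 \<in> D"
      using diff_closed_zero [OF bx] diff_closed_zero [OF block_diff_closed]
      by (auto simp: D_def smul_def zero_fun_def [symmetric] intro!: bexI [of _ 0])
  next
    fix k l assume "k \<in> D" "l \<in> D"
    then obtain v w where v: "v \<in> block \<tau>" "v - smul (of_int k) x0 \<in> bx"
      and w: "w \<in> block \<tau>" "w - smul (of_int l) x0 \<in> bx" by (auto simp: D_def)
    have "(v - w) - smul (of_int (k - l)) x0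
      = (v - smul (of_int k) x0) - (w - smul (of_int l) x0)"
      by (simp add: fun_eq_iff algebra_simps)
    then have "(v - w) - smul (of_int (k - l)) x0 \<in> bx"
      using diff_closed_diff [OF bx v(2) w(2)] by (simp only:)
    then show "k - l \<in> D"
      using diff_closed_diff [OF block_diff_closed v(1) w(1)] by (auto simp: D_def)
  qed
  then obtain d where d: "d \<in> D" "\<And>k. k \<in> D \<Longrightarrow> d dvd k"
    by (rule int_diff_closed_principal) blast
  then obtain h where h: "h \<in> block \<tau>" "h - smul (of_int d) x0 \<in> bx" by (auto simp: D_def)
  have "\<exists>k::int. v - smul (of_int k) h \<in> bx" if v: "v \<in> block \<tau>" for v
  proof -
    have "v \<in> X" using v by (simp add: block_def)
    then obtain k :: int where k: "v - smul (of_int k) x0 \<in> bx" using gen by blast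
    then have "k \<in> D" using v by (auto simp: D_def)
    then obtain l where l: "k = d * l" using d(2) by (meson dvdE)
    have "v - smul (of_int l) h
      = (v - smul (of_int k) x0) - smul (of_int l) (h - smul (of_int d) x0)"
      by (simp add: fun_eq_iff algebra_simps l)
    then show ?thesis
      using diff_closed_diff [OF bx k diff_closed_smul [OF bx h(2), of l]] by metis
  qed
  then show ?thesis using that h(1) by blast
qed

text \<open>The retraction \<open>f\<close> splits off from \<open>block \<tau>\<close> the pure rank-one subgroup containing the
  \<open>\<tau>\<close>-component of \<open>\<pi> x0\<close>; hence \<open>\<epsilon>\<close> fixes \<open>\<pi> x0\<close> and maps \<open>\<pi> X\<close> to itself.\<close>

lemma indecomposable_image_rank_one:
  assumes \<pi>: "\<pi> ` X \<subseteq> X" "additive_on X \<pi>" "\<And>x. x \<in> X \<Longrightarrow> \<pi> (\<pi> x) = \<pi> x"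
    and indec: "\<And>\<epsilon>. \<lbrakk>\<epsilon> ` \<pi> ` X \<subseteq> \<pi> ` X; additive_on (\<pi> ` X) \<epsilon>;
      \<And>v. v \<in> \<pi> ` X \<Longrightarrow> \<epsilon> (\<epsilon> v) = \<epsilon> v\<rbrakk>
      \<Longrightarrow> (\<forall>v\<in>\<pi> ` X. \<epsilon> v = 0) \<or> (\<forall>v\<in>\<pi> ` X. \<epsilon> v = v)"
  shows "\<exists>f :: ('j \<Rightarrow> rat) \<Rightarrow> rat. (\<forall>v w. f (v + w) = f v + f w) \<and>
    (\<forall>v\<in>block \<tau>. f (\<pi> v) = 0 \<longrightarrow> \<pi> v = 0)"
proof (cases "\<forall>v\<in>block \<tau>. \<pi> v = 0")
  case True
  then show ?thesis by (intro exI [of _ "\<lambda>_. 0"]) auto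
next
  case False
  \<comment> \<open>The \<tau>-component of \<open>x0\<close> itself need not lie in
    \<open>X\<close>; that of \<open>m x0\<close> does.\<close>
  define w where "w = part t \<tau> (smul (of_int m) x0)"
  have w: "w \<in> block \<tau>" using part_bx_block [OF mX [OF x0]] by (simp add: w_def)
  \<comment> \<open>This selects the line to split off. If \<open>\<pi> w = 0\<close> there is no
    constraint, and any vector of the block not killed by \<open>\<pi>\<close> serves, with
    \<open>b = 0\<close>; otherwise \<open>w\<close> itself is taken.\<close>
  have "\<exists>v\<in>block \<tau>. \<exists>b. \<pi> v \<noteq> 0 \<and> \<pi> w = smul b (\<pi> v)"
  proof (cases "\<pi> w = 0")
    case True
    then show ?thesis using False smul_zero by metis
  next
    case False
    then show ?thesis using w smul_one by metis
  qed
  then obtain v0 b where v0: "v0 \<in> block \<tau>" "\<pi> v0 \<noteq> 0" "\<pi> w = smul b (\<pi> v0)" by blast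
  define u where "u = \<pi> v0"
  have HX: "v \<in> block \<tau> \<Longrightarrow> v \<in> X" for v by (simp add: block_def)
  have u: "u \<in> block \<tau>" "u \<noteq> 0" "\<pi> u = u"
    using endo_block [OF \<pi>(1,2) v0(1)] v0(2) \<pi>(3) [OF HX [OF v0(1)]] by (simp_all add: u_def)
  then have pu: "part t \<tau> u = u" by (simp add: block_def)
  let ?J = "{j \<in> J. t j = \<tau>}"
  have "\<exists>j\<in>J. t j = \<tau>"
  proof (rule ccontr)
    assume *: "\<not> ?thesis"
    have "u j = 0" for j
      using * pu supp [OF HX [OF u(1)], of j] by (cases "j \<in> J") (metis part_def)+
    then show False using u(2) by (simp add: fun_eq_iff)
  qed
  then have S\<tau>: "diff_closed (S \<tau>)" using S by blast
  obtain h where h: "h \<in> block \<tau>" "\<And>v. v \<in> block \<tau> \<Longrightarrow> \<exists>k::int. v - smul (of_int k) h \<in> bx"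
    using block_generator by blast
  have genJ: "\<exists>k::int. v - smul (of_int k) h \<in> box ?J (\<lambda>_. S \<tau>)" if v: "v \<in> block \<tau>" for v
    using h(2) [OF v] diff_closed_diff [OF block_diff_closed v diff_closed_smul [OF block_diff_closed h(1)]]
    unfolding bx_block [symmetric] by blast
  have mh: "smul (of_int m) h \<in> box ?J (\<lambda>_. S \<tau>)"
    using mX [OF HX [OF h(1)]] diff_closed_smul [OF block_diff_closed h(1)]
    unfolding bx_block [symmetric] by blast
  have suppJ: "v j = 0" if "v \<in> block \<tau>" "j \<notin> ?J" for v j
  proof (cases "j \<in> J")
    case True
    then have "part t \<tau> v j = 0" using that(2) by (simp add: part_def)
    then show ?thesis using that(1) by (simp add: block_def)
  qed (use supp [OF HX [OF that(1)]] in blast)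
  have boxJ: "box ?J (\<lambda>_. S \<tau>) \<subseteq> block \<tau>" using bx_block by blast
  have finJ': "finite ?J" using finJ by simp
  obtain f :: "('j \<Rightarrow> rat) \<Rightarrow> rat"
    where f_add: "\<And>v w. f (v + w) = f v + f w" and f_smul: "\<And>c v. f (smul c v) = c * f v"
      and fu: "f u = 1" and fH: "\<And>v. v \<in> block \<tau> \<Longrightarrow> smul (f v) u \<in> block \<tau>"
    by (rule box_retraction [of ?J "S \<tau>" "block \<tau>" h m u, OF finJ' S\<tau> block_diff_closed _ boxJ h(1) m mh genJ u(1,2)],
        erule (1) suppJ, assumption) (rule that)
  \<comment> \<open>The identity on all other types, and on the \<tau>-component the retraction onto
    the line of \<open>u\<close>.\<close>
  define \<epsilon> where "\<epsilon> = (\<lambda>v. v - part t \<tau> v + smul (f (part t \<tau> v)) u)"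
  have \<epsilon>_add: "\<epsilon> (v + w) = \<epsilon> v + \<epsilon> w" for v w
    by (simp add: \<epsilon>_def part_add f_add smul_add_left)
  have part_\<epsilon>: "part t \<tau> (\<epsilon> v) = smul (f (part t \<tau> v)) u" for v
    by (simp add: \<epsilon>_def part_add part_diff part_part part_smul pu)
  have "\<epsilon> (\<epsilon> v) = \<epsilon> v" for v
  proof -
    have "\<epsilon> (\<epsilon> v) = \<epsilon> v - part t \<tau> (\<epsilon> v) + smul (f (part t \<tau> (\<epsilon> v))) u"
      by (subst \<epsilon>_def) simp
    then show ?thesis by (simp add: part_\<epsilon> f_smul fu)
  qed
  moreover have "\<epsilon> v \<in> \<pi> ` X" if v': "v \<in> \<pi> ` X" for v
  proof -
    obtain x where x: "x \<in> X" "v = \<pi> x" using v' by blast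
    obtain k :: int where k: "x - smul (of_int k) x0 \<in> bx" using gen [OF x(1)] by blast
    define z where "z = x - smul (of_int k) x0"
    have z: "z \<in> bx" "z \<in> X" using k box_X by (auto simp: z_def)
    have x0k: "smul (of_int k) x0 \<in> X" using diff_closed_smul [OF X x0] .
    have "x = z + smul (of_int k) x0" by (simp add: z_def)
    then have v: "v = \<pi> z + smul (of_int k) (\<pi> x0)"
      using x(2) additive_onD [OF \<pi>(2) z(2) x0k] additive_on_smul [OF X \<pi>(2) x0] by simp
    define y where "y = \<pi> (part t \<tau> z)"
    have y: "y \<in> block \<tau>" "\<pi> y = y"
      using endo_block [OF \<pi>(1,2) part_bx_block [OF z(1)]] \<pi>(3) [OF HX [OF part_bx_block [OF z(1)]]]
      by (auto simp: y_def)
    have "smul (of_int m) (part t \<tau> (\<pi> x0)) = part t \<tau> (\<pi> (smul (of_int m) x0))"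
      by (simp add: part_smul additive_on_smul [OF X \<pi>(2) x0])
    also have "\<dots> = \<pi> w"
      using endo_part [OF \<pi>(1,2) mX [OF x0]] by (simp add: w_def)
    also have "\<dots> = smul b u" using v0(3) by (simp add: u_def)
    finally have px0: "part t \<tau> (\<pi> x0) = smul (b / of_int m) u"
      using m by (auto simp: fun_eq_iff field_simps)
    define c where "c = of_int k * (b / of_int m)"
    \<comment> \<open>Of the \<tau>-component of \<open>v\<close>, only \<open>y\<close> is changed
      by the retraction: the contribution of \<open>\<pi> x0\<close> is a multiple of
      \<open>u\<close>, which is fixed because \<open>f u = 1\<close>.\<close>
    have pv: "part t \<tau> v = y + smul c u"
      unfolding v part_add part_smul px0 y_def endo_part [OF \<pi>(1,2) z(1)]
      by (simp add: smul_smul c_def)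
    have "\<epsilon> v = v - y + smul (f y) u"
      by (simp add: \<epsilon>_def pv f_add f_smul fu smul_add_left)
    \<comment> \<open>By the choice of \<open>f\<close> the last vector is in the block, and as a
      rational multiple of the fixed vector \<open>u\<close> it is fixed by \<open>\<pi>\<close>.
      Thus all three terms are values of \<open>\<pi>\<close> on \<open>X\<close>.\<close>
    also have "\<dots> = \<pi> (x - y + smul (f y) u)"
    proof -
      have "\<pi> (smul (f y) u) = smul (f y) u"
        using additive_on_fixed_smul [OF X \<pi>(2)] u HX fH y(1) by blast
      then show ?thesis
        using additive_onD [OF \<pi>(2) diff_closed_diff [OF X x(1) HX [OF y(1)]] HX [OF fH [OF y(1)]]]
          additive_on_diff [OF X \<pi>(2) x(1) HX [OF y(1)]] x(2) y(2) by simp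
    qed
    finally have "\<epsilon> v = \<pi> (x - y + smul (f y) u)" .
    moreover have "x - y + smul (f y) u \<in> X"
      using diff_closed_add [OF X diff_closed_diff [OF X x(1) HX [OF y(1)]] HX [OF fH [OF y(1)]]] .
    ultimately show ?thesis by blast
  qed
  ultimately have "(\<forall>v\<in>\<pi> ` X. \<epsilon> v = 0) \<or> (\<forall>v\<in>\<pi> ` X. \<epsilon> v = v)"
    using indec [of \<epsilon>] \<epsilon>_add by (auto simp: additive_on_def image_subset_iff)
  \<comment> \<open>Since \<open>u\<close> is nonzero, this excludes the first alternative and
    forces \<open>\<epsilon>\<close> to be the identity on the image of
    \<open>\<pi>\<close>.\<close>
  moreover have "\<epsilon> u = u"
    by (simp add: \<epsilon>_def pu fu smul_one)
  moreover have "u \<in> \<pi> ` X" using HX [OF v0(1)] by (simp add: u_def)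
  ultimately have id: "\<epsilon> v = v" if "v \<in> \<pi> ` X" for v using that u(2) by auto
  have "\<pi> v = 0" if v: "v \<in> block \<tau>" "f (\<pi> v) = 0" for v
  proof -
    have "part t \<tau> (\<pi> v) = \<pi> v" using endo_block [OF \<pi>(1,2) v(1)] by (simp add: block_def)
    then have "\<epsilon> (\<pi> v) = smul 0 u" by (simp add: \<epsilon>_def v(2))
    then show ?thesis using id [of "\<pi> v"] HX [OF v(1)] by (simp add: smul_zero)
  qed
  then show ?thesis using f_add by blast
qed

end

section \<open>Rank and rational coordinates of groups\<close>

text \<open>Gaussian elimination, one coordinate at a time: the pivot vector \<open>a\<close> clears
  coordinate \<open>i\<close> from the others, and its own coefficient \<open>b\<close> is
  determined afterwards by the relation among the reduced vectors.\<close>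

lemma rat_vectors_dependent:
  fixes q :: "'m \<Rightarrow> 'i \<Rightarrow> rat"
  assumes "finite I" and "finite M" and "card I < card M"
  shows "\<exists>c :: 'm \<Rightarrow> rat. (\<exists>x\<in>M. c x \<noteq> 0) \<and> (\<forall>i\<in>I. (\<Sum>x\<in>M. c x * q x i) = 0)"
  using assms
proof (induction I arbitrary: M q)
  case empty
  then show ?case by (intro exI [of _ "\<lambda>_. 1"]) (auto simp: card_gt_0_iff)
next
  case (insert i I)
  show ?case
  proof (cases "\<forall>x\<in>M. q x i = 0")
    case True
    have "card I < card M" using insert by simp
    then obtain c where "\<exists>x\<in>M. c x \<noteq> 0" "\<forall>i\<in>I. (\<Sum>x\<in>M. c x * q x i) = 0"
      using insert.IH [OF insert.prems(1), of q] by blast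
    then show ?thesis using True by (intro exI [of _ c]) auto
  next
    case False
    then obtain a where a: "a \<in> M" "q a i \<noteq> 0" by blast
    define M' where "M' = M - {a}"
    have M: "M = insert a M'" "a \<notin> M'" "finite M'" using a insert.prems by (auto simp: M'_def)
    have "card I < card M'" using insert.hyps insert.prems M by simp
    then obtain c where c: "\<exists>x\<in>M'. c x \<noteq> 0"
      "\<forall>k\<in>I. (\<Sum>x\<in>M'. c x * (q x k - q x i / q a i * q a k)) = 0"
      using insert.IH [OF M(3), of "\<lambda>x k. q x k - q x i / q a i * q a k"] by blast
    define b where "b = - (\<Sum>x\<in>M'. c x * (q x i / q a i))"
    have sum: "(\<Sum>x\<in>M. (c(a := b)) x * q x k) = (\<Sum>x\<in>M'. c x * (q x k - q x i / q a i * q a k))"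
      for k
    proof -
      have "(\<Sum>x\<in>M'. (c(a := b)) x * q x k) = (\<Sum>x\<in>M'. c x * q x k)"
        using M(2) by (intro sum.cong) auto
      then have "(\<Sum>x\<in>M. (c(a := b)) x * q x k) = b * q a k + (\<Sum>x\<in>M'. c x * q x k)"
        using M by simp
      also have "\<dots> = (\<Sum>x\<in>M'. c x * (q x k - q x i / q a i * q a k))"
        by (simp add: b_def sum_distrib_right sum_subtractf right_diff_distrib mult.assoc)
      finally show ?thesis .
    qed
    have "(\<Sum>x\<in>M. (c(a := b)) x * q x k) = 0" if "k \<in> insert i I" for k
      unfolding sum using that c(2) a(2) by auto
    moreover have "\<exists>x\<in>M. (c(a := b)) x \<noteq> 0" using c(1) M by auto
    ultimately show ?thesis by blast
  qed
qed

text \<open>A nontrivial rational relation is a nonzero multiple of an integral one; exponents in a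
  group have to be integers.\<close>

lemma rat_vectors_int_dependent:
  fixes q :: "'m \<Rightarrow> 'i \<Rightarrow> rat"
  assumes "finite I" and "finite M" and "card I < card M"
  obtains c :: "'m \<Rightarrow> int" and x where "x \<in> M" and "c x \<noteq> 0"
    and "\<And>i. i \<in> I \<Longrightarrow> (\<Sum>x\<in>M. of_int (c x) * q x i) = 0"
proof -
  obtain b where b: "\<exists>x\<in>M. b x \<noteq> 0" "\<forall>i\<in>I. (\<Sum>x\<in>M. b x * q x i) = 0"
    using rat_vectors_dependent [OF assms, of q] by blast
  have "M \<noteq> {}" using assms by auto
  then obtain r and c a :: "'m \<Rightarrow> int" where c: "\<And>x. x \<in> M \<Longrightarrow> b x = r * of_int (c x)"
    using rat_family_primitive [OF assms(2)] by metis
  obtain x where x: "x \<in> M" "b x \<noteq> 0" using b(1) by blast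
  have "r \<noteq> 0" "c x \<noteq> 0" using c [OF x(1)] x(2) by auto
  moreover have "(\<Sum>x\<in>M. of_int (c x) * q x i) = 0" if "i \<in> I" for i
  proof -
    have "r * (\<Sum>x\<in>M. of_int (c x) * q x i) = (\<Sum>x\<in>M. b x * q x i)"
      unfolding sum_distrib_left by (intro sum.cong) (auto simp: c)
    then show ?thesis using b(2) that \<open>r \<noteq> 0\<close> by simp
  qed
  ultimately show ?thesis using that x(1) by blast
qed

section \<open>Homomorphisms into the rationals, and rank\<close>

lemma rat_group_simps [simp]:
  "carrier rat_group = UNIV" "x \<otimes>\<^bsub>rat_group\<^esub> y = x + y" "\<one>\<^bsub>rat_group\<^esub> = 0"
  by (simp_all add: rat_group_def)

lemma comm_group_rat_group: "comm_group rat_group"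
  by (rule comm_groupI) (auto intro: exI [of _ "- x" for x] simp: add.assoc)

lemma group_rat_group: "group rat_group"
  using comm_group_rat_group by (simp add: comm_group_def)

lemma inv_rat_group [simp]: "inv\<^bsub>rat_group\<^esub> x = - x"
  using group.inv_equality [OF group_rat_group, of "- x" x] by simp

lemma subgroup_rat_group_diff_closed: "subgroup S rat_group \<Longrightarrow> diff_closed S"
  using subgroup.one_closed [of S rat_group] subgroup.m_closed [of S rat_group]
    subgroup.m_inv_closed [of S rat_group]
  by (fastforce simp: diff_closed_def diff_conv_add_uminus simp del: add_uminus_conv_diff)

context comm_group
begin

lemma hom_rat_mult: "h \<in> hom G rat_group \<Longrightarrow> x \<in> carrier G \<Longrightarrow> y \<in> carrier G \<Longrightarrow> h (x \<otimes> y) = h x + h y"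
  by (simp add: hom_def)

lemma hom_rat_one: "h \<in> hom G rat_group \<Longrightarrow> h \<one> = 0"
  using hom_rat_mult [of h \<one> \<one>] by simp

lemma hom_rat_inv: "h \<in> hom G rat_group \<Longrightarrow> x \<in> carrier G \<Longrightarrow> h (inv x) = - h x"
  using hom_rat_mult [of h x "inv x"] hom_rat_one [of h] by simp

lemma hom_rat_int_pow:
  assumes h: "h \<in> hom G rat_group" and x: "x \<in> carrier G"
  shows "h (x [^] (k::int)) = of_int k * h x"
proof (induction k rule: int_induct [where k = 0])
  case base
  then show ?case using hom_rat_one [OF h] by simp
next
  case (step1 i)
  then show ?case using x by (simp add: int_pow_mult hom_rat_mult [OF h] algebra_simps)
next
  case (step2 i)
  then show ?case
    using x by (simp add: int_pow_diff hom_rat_mult [OF h] hom_rat_inv [OF h] algebra_simps)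
qed

lemma hom_rat_nat_pow:
  "h \<in> hom G rat_group \<Longrightarrow> x \<in> carrier G \<Longrightarrow> h (x [^] (n::nat)) = of_nat n * h x"
  using hom_rat_int_pow [of h x "int n"] by (simp add: int_pow_int)

lemma hom_rat_finprod:
  assumes h: "h \<in> hom G rat_group" and "finite M" and "f \<in> M \<rightarrow> carrier G"
  shows "h (finprod G f M) = (\<Sum>x\<in>M. h (f x))"
  using assms(2,3)
proof (induction M)
  case empty
  then show ?case using hom_rat_one [OF h] by simp
next
  case (insert a M)
  then show ?case by (simp add: hom_rat_mult [OF h] Pi_def)
qed

text \<open>Jointly injective homomorphisms embed the group into a rational vector space of
  dimension \<open>card I\<close>, and an integral relation between images pulls back to the
  group.\<close>

lemma group_rank_le:
  assumes I: "finite I" and Q: "\<And>i. i \<in> I \<Longrightarrow> Q i \<in> hom G rat_group"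
    and inj: "\<And>x. x \<in> carrier G \<Longrightarrow> (\<And>i. i \<in> I \<Longrightarrow> Q i x = 0) \<Longrightarrow> x = \<one>"
  shows "group_rank G \<le> card I"
proof -
  have bound: "card M \<le> card I" if M: "int_independent G M" for M
  proof (rule ccontr)
    assume "\<not> ?thesis"
    moreover have fin: "finite M" and sub: "M \<subseteq> carrier G" using M by (auto simp: int_independent_def)
    ultimately have lt: "card I < card M" by simp
    obtain c :: "'a \<Rightarrow> int" and x where x: "x \<in> M" "c x \<noteq> 0"
      and c: "\<And>i. i \<in> I \<Longrightarrow> (\<Sum>x\<in>M. of_int (c x) * Q i x) = 0"
      by (rule rat_vectors_int_dependent [OF I fin lt, of "\<lambda>x i. Q i x"]) (rule that)
    let ?f = "\<lambda>x. x [^] c x"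
    have f: "?f \<in> M \<rightarrow> carrier G" using sub by auto
    have "Q i (finprod G ?f M) = 0" if i: "i \<in> I" for i
    proof -
      have "Q i (finprod G ?f M) = (\<Sum>x\<in>M. Q i (?f x))" by (rule hom_rat_finprod [OF Q [OF i] fin f])
      also have "\<dots> = (\<Sum>x\<in>M. of_int (c x) * Q i x)"
        using sub by (intro sum.cong) (auto simp: hom_rat_int_pow [OF Q [OF i]])
      finally show ?thesis using c [OF i] by simp
    qed
    then have "finprod G ?f M = \<one>" using inj f by (simp add: finprod_closed)
    then show False using M x by (auto simp: int_independent_def)
  qed
  \<comment> \<open>The empty set ensures that the maximum defining the rank is taken over a
    nonempty set.\<close>
  have "int_independent G {}" by (simp add: int_independent_def)
  moreover have "finite (card ` {M. int_independent G M})"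
    using bound by (auto intro: finite_subset [of _ "{..card I}"])
  ultimately show ?thesis
    unfolding group_rank_def using bound by (intro Max.boundedI) auto
qed

text \<open>Every \<open>x\<close> depends on a fixed independent element \<open>a\<close>: some
  nonzero power \<open>x [^] n\<close> equals a power \<open>a [^] k\<close>, and
  \<open>k / n\<close> is the coordinate of \<open>x\<close>.\<close>

lemma rank_one_embedding:
  assumes r: "rank_one_group G"
  obtains h where "h \<in> hom G rat_group" and "inj_on h (carrier G)"
proof -
  have tf: "\<And>x n::nat. x \<in> carrier G \<Longrightarrow> 0 < n \<Longrightarrow> x [^] n = \<one> \<Longrightarrow> x = \<one>"
    using r by (auto simp: rank_one_group_def tffr_group_def torsion_free_group_def)
  have tfi: "x = \<one>" if "x \<in> carrier G" "k \<noteq> 0" "x [^] (k::int) = \<one>" for x k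
  proof -
    have "x [^] nat \<bar>k\<bar> = \<one>"
    proof (cases "k > 0")
      case True
      then show ?thesis using that(3) by (simp add: int_pow_int [symmetric])
    next
      case False
      then have "x [^] int (nat \<bar>k\<bar>) = inv (x [^] k)" using int_pow_neg [OF that(1), of k] by simp
      then show ?thesis using that(3) by (simp add: int_pow_int)
    qed
    then show ?thesis using tf [OF that(1), of "nat \<bar>k\<bar>"] that(2) by simp
  qed
  obtain N where N: "\<And>M. int_independent G M \<Longrightarrow> card M \<le> N"
    using r by (auto simp: rank_one_group_def tffr_group_def finite_rank_def)
  let ?C = "card ` {M. int_independent G M}"
  have fin: "finite ?C" using N by (auto intro: finite_subset [of _ "{..N}"])
  have "int_independent G {}" by (simp add: int_independent_def)
  then have "Max ?C \<in> ?C" using fin by (intro Max_in) auto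
  moreover have max1: "Max ?C = 1" using r by (simp add: rank_one_group_def group_rank_def)
  ultimately obtain M where M: "int_independent G M" "card M = 1" by auto
  then obtain a where "M = {a}" by (auto simp: card_1_singleton_iff)
  then have ind: "int_independent G {a}" and a: "a \<in> carrier G"
    using M by (auto simp: int_independent_def)
  have a0: "k = 0" if "a [^] (k::int) = \<one>" for k
    using ind a that unfolding int_independent_def
    by (auto dest: spec [of _ "\<lambda>_. k"])
  have ex: "\<exists>n k. n \<noteq> 0 \<and> x [^] (n::int) = a [^] (k::int)" if x: "x \<in> carrier G" for x
  proof (cases "x = a")
    case True
    then show ?thesis by (intro exI [of _ 1]) auto
  next
    case False
    have "\<not> int_independent G {a, x}"
    proof
      assume "int_independent G {a, x}"
      then have "card {a, x} \<le> Max ?C" using fin by (intro Max_ge) auto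
      then show False using max1 False by simp
    qed
    then obtain c :: "'a \<Rightarrow> int" where c: "finprod G (\<lambda>y. y [^] c y) {a, x} = \<one>" "c a \<noteq> 0 \<or> c x \<noteq> 0"
      using a x by (auto simp: int_independent_def)
    have "finprod G (\<lambda>y. y [^] c y) {a, x} = a [^] c a \<otimes> x [^] c x"
      using a x False by simp
    then have ax: "a [^] c a \<otimes> x [^] c x = \<one>" using c(1) by simp
    have "c x \<noteq> 0"
    proof
      assume "c x = 0"
      then have "a [^] c a = \<one>" using ax a by simp
      then show False using a0 c(2) \<open>c x = 0\<close> by auto
    qed
    moreover have "x [^] c x = a [^] (- c a)"
      using ax a x by (metis int_pow_closed int_pow_neg inv_equality inv_inv inv_closed)
    ultimately show ?thesis by blast
  qed
  \<comment> \<open>The fraction does not depend on the relation chosen, because a power of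
    \<open>a\<close> determines its exponent.\<close>
  define h where "h = (\<lambda>x. THE q. \<exists>n k. n \<noteq> 0 \<and> x [^] (n::int) = a [^] (k::int) \<and> q = (of_int k / of_int n :: rat))"
  have h: "h x = of_int k / of_int n"
    if x: "x \<in> carrier G" and n: "n \<noteq> 0" "x [^] (n::int) = a [^] (k::int)" for x n k
    unfolding h_def
  proof (rule the_equality)
    show "\<exists>n' k'. n' \<noteq> 0 \<and> x [^] (n'::int) = a [^] (k'::int)
        \<and> (of_int k / of_int n :: rat) = of_int k' / of_int n'"
      using n by blast
  next
    fix q :: rat
    assume "\<exists>n' k'. n' \<noteq> 0 \<and> x [^] (n'::int) = a [^] (k'::int) \<and> q = of_int k' / of_int n'"
    then obtain n' k' where n': "n' \<noteq> 0" "x [^] (n'::int) = a [^] (k'::int)" "q = of_int k' / of_int n'"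
      by blast
    have "a [^] (k * n') = x [^] (n * n')" using n(2) a x by (metis int_pow_pow)
    also have "\<dots> = a [^] (k' * n)" using n'(2) a x by (metis int_pow_pow mult.commute)
    finally have "a [^] (k * n' - k' * n) = \<one>" using a by (simp add: int_pow_diff)
    then have "k * n' - k' * n = 0" by (rule a0)
    then have "k * n' = k' * n" by simp
    then have "(of_int k * of_int n' :: rat) = of_int k' * of_int n" by (metis of_int_mult)
    then show "q = of_int k / of_int n" unfolding n'(3) using n(1) n'(1) by (simp add: frac_eq_eq)
  qed
  have hom: "h \<in> hom G rat_group"
  proof (rule homI)
    fix x y assume x: "x \<in> carrier G" and y: "y \<in> carrier G"
    obtain n k where n: "n \<noteq> 0" "x [^] (n::int) = a [^] (k::int)" using ex [OF x] by blast
    obtain n' k' where n': "n' \<noteq> 0" "y [^] (n'::int) = a [^] (k'::int)" using ex [OF y] by blast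
    have "(x \<otimes> y) [^] (n * n') = x [^] (n * n') \<otimes> y [^] (n' * n)"
      using x y by (simp add: int_pow_distrib mult.commute)
    also have "\<dots> = a [^] (k * n' + k' * n)"
      using x y a n n' by (metis int_pow_pow int_pow_mult)
    finally have "h (x \<otimes> y) = of_int (k * n' + k' * n) / of_int (n * n')"
      using h [of "x \<otimes> y" "n * n'"] x y n(1) n'(1) by simp
    then show "h (x \<otimes> y) = h x \<otimes>\<^bsub>rat_group\<^esub> h y"
      using h [OF x n] h [OF y n'] n(1) n'(1) by (simp add: add_frac_eq)
  qed simp
  have ker: "x = \<one>" if x: "x \<in> carrier G" "h x = 0" for x
  proof -
    obtain n k where n: "n \<noteq> 0" "x [^] (n::int) = a [^] (k::int)" using ex [OF x(1)] by blast
    then have "k = 0" using h [OF x(1) n] x(2) by simp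
    then show ?thesis using n tfi [OF x(1)] by simp
  qed
  have "inj_on h (carrier G)"
  proof (rule inj_onI)
    fix x y assume xy: "x \<in> carrier G" "y \<in> carrier G" "h x = h y"
    then have "h (x \<otimes> inv y) = 0" using hom_rat_mult [OF hom] hom_rat_inv [OF hom] by simp
    then have "x \<otimes> inv y = \<one>" using ker xy by simp
    then show "x = y" using xy by (metis inv_equality inv_inv inv_closed)
  qed
  then show ?thesis using that hom by blast
qed

lemma rank_one_type_nonempty:
  assumes "rank_one_group G"
  shows "type_of_group G \<noteq> {}"
proof -
  obtain h where h: "h \<in> hom G rat_group" "inj_on h (carrier G)"
    using rank_one_embedding [OF assms] .
  interpret h: group_hom G rat_group h
    using h(1) group_rat_group by (simp add: group_hom_def group_hom_axioms_def)
  have "subgroup (h ` carrier G) rat_group" by (rule h.img_is_subgroup)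
  moreover have "h \<in> iso G (rat_group\<lparr>carrier := h ` carrier G\<rparr>)"
    using h by (auto simp: iso_def hom_def bij_betw_def)
  ultimately show ?thesis by (auto simp: type_of_group_def is_iso_def)
qed

section \<open>Projections of direct decompositions, and idempotents\<close>

lemma direct_decomposition_components:
  assumes d: "direct_decomposition G I B"
  obtains p where "\<And>i. i \<in> I \<Longrightarrow> p i \<in> hom G (G\<lparr>carrier := B i\<rparr>)"
    and "\<And>x. x \<in> carrier G \<Longrightarrow> finprod G (\<lambda>i. p i x) I = x"
    and "\<And>y i. y \<in> (\<Pi> i\<in>I. B i) \<Longrightarrow> i \<in> I \<Longrightarrow> p i (finprod G y I) = y i"
proof -
  let ?P = "product_group I (\<lambda>i. G\<lparr>carrier := B i\<rparr>)" and ?\<Phi> = "\<lambda>x. finprod G x I"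
  have sub: "\<And>i. i \<in> I \<Longrightarrow> subgroup (B i) G" and iso: "?\<Phi> \<in> iso ?P G"
    using d by (auto simp: direct_decomposition_def)
  have P: "group ?P" using sub by (intro product_group) (auto intro: subgroup.subgroup_is_group)
  define p where "p = (\<lambda>i x. inv_into (carrier ?P) ?\<Phi> x i)"
  have bij: "bij_betw ?\<Phi> (PiE I B) (carrier G)" using iso by (simp add: iso_def)
  have inv: "inv_into (carrier ?P) ?\<Phi> \<in> iso G ?P" using group.iso_set_sym [OF P iso] .
  have mem: "inv_into (carrier ?P) ?\<Phi> x \<in> PiE I B" if "x \<in> carrier G" for x
    using inv that by (auto simp: iso_def hom_def)
  have "p i \<in> hom G (G\<lparr>carrier := B i\<rparr>)" if i: "i \<in> I" for i
  proof (rule homI)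
    show "p i x \<in> carrier (G\<lparr>carrier := B i\<rparr>)" if "x \<in> carrier G" for x
      using mem [OF that] i by (auto simp: p_def)
    show "p i (x \<otimes> y) = p i x \<otimes>\<^bsub>G\<lparr>carrier := B i\<rparr>\<^esub> p i y" if "x \<in> carrier G" "y \<in> carrier G" for x y
      using hom_mult [of "inv_into (carrier ?P) ?\<Phi>" G ?P x y] inv that i by (simp add: p_def iso_def)
  qed
  moreover have "finprod G (\<lambda>i. p i x) I = x" if x: "x \<in> carrier G" for x
  proof -
    have "?\<Phi> (inv_into (PiE I B) ?\<Phi> x) = x"
      using bij_betw_inv_into_right [OF bij x] .
    then show ?thesis by (simp add: p_def)
  qed
  moreover have "p i (finprod G y I) = y i" if y: "y \<in> (\<Pi> i\<in>I. B i)" and i: "i \<in> I" for y i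
  proof -
    have "y \<in> I \<rightarrow> carrier G" using y sub subgroup.subset by fast
    then have "finprod G y I = finprod G (restrict y I) I"
      by (intro finprod_cong') auto
    moreover have "restrict y I \<in> PiE I B" using y by auto
    ultimately have "inv_into (PiE I B) ?\<Phi> (finprod G y I) = restrict y I"
      using inv_into_f_f [OF bij_betw_imp_inj_on [OF bij], of "restrict y I"] by simp
    then show ?thesis using i by (simp add: p_def)
  qed
  ultimately show ?thesis using that by blast
qed

lemma component_of_summand:
  assumes d: "direct_decomposition G I B"
    and p: "\<And>y i. y \<in> (\<Pi> i\<in>I. B i) \<Longrightarrow> i \<in> I \<Longrightarrow> p i (finprod G y I) = y i"
    and ij: "i \<in> I" "j \<in> I" and x: "x \<in> B i"
  shows "p j x = (if j = i then x else \<one>)"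
proof -
  have I: "finite I" and sub: "\<And>i. i \<in> I \<Longrightarrow> subgroup (B i) G"
    using d by (auto simp: direct_decomposition_def)
  let ?y = "\<lambda>k. if i = k then x else \<one>"
  have y: "?y \<in> (\<Pi> i\<in>I. B i)" using x sub subgroup.one_closed by fastforce
  have "x \<in> carrier G" using x sub [OF ij(1)] subgroup.subset by blast
  then have "finprod G ?y I = x" using finprod_singleton [OF ij(1) I, of "\<lambda>_. x"] by auto
  then show ?thesis using p [OF y ij(2)] by auto
qed

text \<open>An idempotent splits the group into its image and its kernel, \<open>x\<close> being the
  product of \<open>e x\<close> and \<open>inv (e x) \<otimes> x\<close>; by indecomposability one
  of the two is trivial.\<close>

lemma indecomposable_idempotent:
  assumes ind: "indecomposable_group G" and e: "e \<in> hom G G"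
    and idem: "\<And>x. x \<in> carrier G \<Longrightarrow> e (e x) = e x"
  shows "(\<forall>x\<in>carrier G. e x = \<one>) \<or> (\<forall>x\<in>carrier G. e x = x)"
proof -
  interpret e: group_hom G G e
    using e is_group by (simp add: group_hom_def group_hom_axioms_def)
  define B where "B = (\<lambda>i::nat. if i = 1 then e ` carrier G else kernel G G e)"
  have sub: "subgroup (B i) G" for i
    by (simp add: B_def e.img_is_subgroup e.subgroup_kernel)
  have B1: "y \<in> carrier G" "e y = y" if "y \<in> B 1" for y
    using that idem by (auto simp: B_def)
  have B2: "y \<in> carrier G" "e y = \<one>" if "y \<in> B 2" for y
    using that by (auto simp: B_def kernel_def)
  let ?P = "product_group {1, 2::nat} (\<lambda>i. G\<lparr>carrier := B i\<rparr>)"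
  have PC: "y 1 \<in> B 1" "y 2 \<in> B 2" if "y \<in> PiE {1, 2::nat} B" for y
    using that by auto
  have fp: "finprod G y {1, 2::nat} = y 1 \<otimes> y 2" if "y 1 \<in> carrier G" "y 2 \<in> carrier G" for y
    using that by simp
  have fpB: "finprod G y {1, 2::nat} = y 1 \<otimes> y 2" if "y \<in> PiE {1, 2::nat} B" for y
    using fp B1(1) [OF PC(1) [OF that]] B2(1) [OF PC(2) [OF that]] .
  have "(\<lambda>y. finprod G y {1, 2::nat}) \<in> iso ?P G"
  proof (rule isoI)
    show "(\<lambda>y. finprod G y {1, 2::nat}) \<in> hom ?P G"
    proof (rule homI)
      fix y assume "y \<in> carrier ?P"
      then have y: "y \<in> PiE {1, 2::nat} B" by simp
      show "finprod G y {1, 2::nat} \<in> carrier G"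
        using B1(1) [OF PC(1) [OF y]] B2(1) [OF PC(2) [OF y]] unfolding fpB [OF y] by simp
    next
      fix y z assume "y \<in> carrier ?P" "z \<in> carrier ?P"
      then have y: "y \<in> PiE {1, 2::nat} B" and z: "z \<in> PiE {1, 2::nat} B" by simp_all
      note c = B1(1) [OF PC(1) [OF y]] B2(1) [OF PC(2) [OF y]] B1(1) [OF PC(1) [OF z]] B2(1) [OF PC(2) [OF z]]
      have "finprod G (y \<otimes>\<^bsub>?P\<^esub> z) {1, 2::nat} = (y 1 \<otimes> z 1) \<otimes> (y 2 \<otimes> z 2)"
        using c by (subst fp) auto
      also have "\<dots> = (y 1 \<otimes> y 2) \<otimes> (z 1 \<otimes> z 2)" using c by (simp add: m_ac)
      finally show "finprod G (y \<otimes>\<^bsub>?P\<^esub> z) {1, 2::nat} = finprod G y {1, 2} \<otimes> finprod G z {1, 2}"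
        by (simp only: fpB [OF y] fpB [OF z])
    qed
  next
    show "bij_betw (\<lambda>y. finprod G y {1, 2::nat}) (carrier ?P) (carrier G)"
    proof (rule bij_betw_imageI)
      show "inj_on (\<lambda>y. finprod G y {1, 2::nat}) (carrier ?P)"
      proof (rule inj_onI)
        fix y z assume "y \<in> carrier ?P" "z \<in> carrier ?P"
          and eq: "finprod G y {1, 2::nat} = finprod G z {1, 2::nat}"
        then have y: "y \<in> PiE {1, 2::nat} B" and z: "z \<in> PiE {1, 2::nat} B" by simp_all
        note c = B1 [OF PC(1) [OF y]] B2 [OF PC(2) [OF y]] B1 [OF PC(1) [OF z]] B2 [OF PC(2) [OF z]]
        have eq': "y 1 \<otimes> y 2 = z 1 \<otimes> z 2" using eq by (simp only: fpB [OF y] fpB [OF z])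
        then have "e (y 1 \<otimes> y 2) = e (z 1 \<otimes> z 2)" by simp
        then have 1: "y 1 = z 1" using c by (simp add: e.hom_mult)
        then have "y 2 = z 2" using eq' c by simp
        then show "y = z" using 1 y z by (intro PiE_ext [OF y z]) auto
      qed
      show "(\<lambda>y. finprod G y {1, 2::nat}) ` carrier ?P = carrier G"
      proof (intro equalityI subsetI)
        fix x assume "x \<in> (\<lambda>y. finprod G y {1, 2::nat}) ` carrier ?P"
        then obtain y where y: "y \<in> PiE {1, 2::nat} B" "x = finprod G y {1, 2}" by auto
        show "x \<in> carrier G"
          using B1(1) [OF PC(1) [OF y(1)]] B2(1) [OF PC(2) [OF y(1)]] unfolding y(2) fpB [OF y(1)] by simp
      next
        fix x assume x: "x \<in> carrier G"
        define y where "y = (\<lambda>i\<in>{1, 2::nat}. if i = 1 then e x else inv (e x) \<otimes> x)"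
        have "inv (e x) \<otimes> x \<in> kernel G G e" using x idem by (simp add: kernel_def)
        then have y: "y \<in> PiE {1, 2::nat} B" using x by (auto simp: y_def B_def)
        have "finprod G y {1, 2} = x" using x unfolding fpB [OF y] by (simp add: y_def m_assoc [symmetric])
        then show "x \<in> (\<lambda>y. finprod G y {1, 2::nat}) ` carrier ?P" using y by force
      qed
    qed
  qed
  then have "direct_decomposition G {1, 2::nat} B" using sub by (simp add: direct_decomposition_def)
  then have "B 1 = {\<one>} \<or> B 2 = {\<one>}" using ind by (simp add: indecomposable_group_def)
  then show ?thesis
  proof
    assume "B 1 = {\<one>}"
    then show ?thesis by (auto simp: B_def)
  next
    assume 2: "B 2 = {\<one>}"
    have "e x = x" if x: "x \<in> carrier G" for x
    proof -
      have "inv (e x) \<otimes> x \<in> B 2" using x idem by (simp add: B_def kernel_def)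
      then show ?thesis using 2 x by (metis e.hom_closed inv_closed inv_equality inv_inv singletonD)
    qed
    then show ?thesis by blast
  qed
qed

end

text \<open>The \<open>\<psi> j\<close> together form an isomorphism onto the product of the
  \<open>S j\<close>. Injectivity and surjectivity are spelled out coordinatewise, so that no
  product group has to be carried along.\<close>

definition rat_coordinates ::
    "('a, 'b) monoid_scheme \<Rightarrow> 'j set \<Rightarrow> ('j \<Rightarrow> rat set) \<Rightarrow> ('j \<Rightarrow> 'a \<Rightarrow> rat) \<Rightarrow> bool"
  where "rat_coordinates G J S \<psi> \<longleftrightarrow>
    (\<forall>j\<in>J. subgroup (S j) rat_group \<and> \<psi> j \<in> hom G (rat_group\<lparr>carrier := S j\<rparr>)) \<and>
    (\<forall>x\<in>carrier G. (\<forall>j\<in>J. \<psi> j x = 0) \<longrightarrow> x = \<one>\<^bsub>G\<^esub>) \<and>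
    (\<forall>v. (\<forall>j\<in>J. v j \<in> S j) \<longrightarrow> (\<exists>x\<in>carrier G. \<forall>j\<in>J. \<psi> j x = v j))"

context comm_group
begin

lemma subgroup_is_comm_group: "subgroup H G \<Longrightarrow> comm_group (G\<lparr>carrier := H\<rparr>)"
  using subgroup.subgroup_is_group [of H G]
  by (intro group.group_comm_groupI) (auto simp: is_group subgroup.mem_carrier m_comm)

text \<open>Since all summands have the same type, one subgroup \<open>S\<close> of the rationals
  represents each of them; the retraction of a block relies on this common \<open>S\<close>. The
  guard covers the empty sum, where no summand supplies a member of \<open>\<rho>\<close>.\<close>

lemma homogeneous_coordinates:
  assumes "homogeneous_of_type \<rho> G"
  shows "\<exists>(n::nat) S \<psi>. (1 \<le> n \<longrightarrow> S \<in> \<rho>) \<and> rat_coordinates G {1..n} (\<lambda>_. S) \<psi>"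
proof -
  obtain n :: nat and B where d: "direct_decomposition G {1..n} B"
    and B: "\<And>i. i \<in> {1..n} \<Longrightarrow> rank_one_group (G\<lparr>carrier := B i\<rparr>)"
      "\<And>i. i \<in> {1..n} \<Longrightarrow> type_of_group (G\<lparr>carrier := B i\<rparr>) = \<rho>"
    using assms unfolding homogeneous_of_type_def by blast
  have sub: "\<And>i. i \<in> {1..n} \<Longrightarrow> subgroup (B i) G" using d by (auto simp: direct_decomposition_def)
  obtain p where p: "\<And>i. i \<in> {1..n} \<Longrightarrow> p i \<in> hom G (G\<lparr>carrier := B i\<rparr>)"
    and p_prod: "\<And>x. x \<in> carrier G \<Longrightarrow> finprod G (\<lambda>i. p i x) {1..n} = x"
    and p_comp: "\<And>y i. y \<in> (\<Pi> i\<in>{1..n}. B i) \<Longrightarrow> i \<in> {1..n} \<Longrightarrow> p i (finprod G y {1..n}) = y i"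
    by (rule direct_decomposition_components [OF d]) (rule that)
  have "\<exists>S. 1 \<le> n \<longrightarrow> S \<in> \<rho>"
  proof (cases "1 \<le> n")
    case True
    then have 1: "1 \<in> {1..n}" by simp
    have "type_of_group (G\<lparr>carrier := B 1\<rparr>) \<noteq> {}"
      using comm_group.rank_one_type_nonempty [OF subgroup_is_comm_group [OF sub [OF 1]] B(1) [OF 1]] .
    then show ?thesis using B(2) [OF 1] by auto
  qed simp
  then obtain S where S: "1 \<le> n \<longrightarrow> S \<in> \<rho>" by blast
  have S': "subgroup S rat_group" "G\<lparr>carrier := B i\<rparr> \<cong> rat_group\<lparr>carrier := S\<rparr>" if i: "i \<in> {1..n}" for i
  proof -
    have "S \<in> type_of_group (G\<lparr>carrier := B i\<rparr>)" using S B(2) [OF i] i by simp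
    then show "subgroup S rat_group" "G\<lparr>carrier := B i\<rparr> \<cong> rat_group\<lparr>carrier := S\<rparr>"
      by (simp_all add: type_of_group_def)
  qed
  then have "\<forall>i\<in>{1..n}. \<exists>\<theta>. \<theta> \<in> iso (G\<lparr>carrier := B i\<rparr>) (rat_group\<lparr>carrier := S\<rparr>)"
    by (metis is_iso_def ex_in_conv)
  then obtain \<theta> where \<theta>: "\<And>i. i \<in> {1..n} \<Longrightarrow> \<theta> i \<in> iso (G\<lparr>carrier := B i\<rparr>) (rat_group\<lparr>carrier := S\<rparr>)"
    by metis
  have \<theta>_hom: "\<theta> i \<in> hom (G\<lparr>carrier := B i\<rparr>) (rat_group\<lparr>carrier := S\<rparr>)"
    and \<theta>_bij: "bij_betw (\<theta> i) (B i) S" if "i \<in> {1..n}" for i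
    using \<theta> [OF that] by (auto simp: iso_def)
  have \<theta>_one: "\<theta> i \<one> = 0" if i: "i \<in> {1..n}" for i
    using hom_one [OF \<theta>_hom [OF i]] subgroup.subgroup_is_group [OF sub [OF i] is_group]
      subgroup.subgroup_is_group [OF S'(1) [OF i] group_rat_group] by simp
  define \<psi> where "\<psi> = (\<lambda>i x. \<theta> i (p i x))"
  have pB: "p i x \<in> B i" if "i \<in> {1..n}" "x \<in> carrier G" for i x
    using p [OF that(1)] that(2) by (auto simp: hom_def)
  have "\<psi> i \<in> hom G (rat_group\<lparr>carrier := S\<rparr>)" if i: "i \<in> {1..n}" for i
    using Group.hom_compose [OF p [OF i] \<theta>_hom [OF i]] by (simp add: \<psi>_def comp_def)
  moreover have "x = \<one>" if x: "x \<in> carrier G" and 0: "\<forall>i\<in>{1..n}. \<psi> i x = 0" for x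
  proof -
    have "p i x = \<one>" if i: "i \<in> {1..n}" for i
    proof -
      have "\<theta> i (p i x) = \<theta> i \<one>" using 0 i \<theta>_one by (simp add: \<psi>_def)
      moreover have "inj_on (\<theta> i) (B i)" using \<theta>_bij [OF i] by (simp add: bij_betw_def)
      ultimately show ?thesis
        using pB [OF i x] subgroup.one_closed [OF sub [OF i]] by (auto dest: inj_onD)
    qed
    then have "finprod G (\<lambda>i. p i x) {1..n} = \<one>" by (intro finprod_one_eqI) auto
    then show ?thesis using p_prod [OF x] by simp
  qed
  moreover have "\<exists>x\<in>carrier G. \<forall>i\<in>{1..n}. \<psi> i x = v i" if v: "\<forall>i\<in>{1..n}. v i \<in> S" for v
  proof -
    define y where "y = (\<lambda>i. inv_into (B i) (\<theta> i) (v i))"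
    have yB: "y i \<in> B i" and \<theta>y: "\<theta> i (y i) = v i" if i: "i \<in> {1..n}" for i
    proof -
      have "v i \<in> \<theta> i ` B i" using v i \<theta>_bij [OF i] by (simp add: bij_betw_def)
      then show "y i \<in> B i" "\<theta> i (y i) = v i" by (auto simp: y_def inv_into_into f_inv_into_f)
    qed
    have "finprod G y {1..n} \<in> carrier G"
      using yB sub subgroup.subset by (intro finprod_closed) fast
    moreover have "\<psi> i (finprod G y {1..n}) = v i" if "i \<in> {1..n}" for i
      using p_comp [of y i] yB \<theta>y that by (simp add: \<psi>_def)
    ultimately show ?thesis by blast
  qed
  ultimately have "rat_coordinates G {1..n} (\<lambda>_. S) \<psi>"
    using S'(1) by (simp add: rat_coordinates_def)
  then show ?thesis using S by blast
qed

text \<open>A coordinate is a pair of a type and a position within its block, so \<open>fst\<close>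
  plays the part of the type map. The last clause ties the abstract summand \<open>R \<tau>\<close>
  to the coordinates of type \<tau>.\<close>

lemma homogeneous_decomposition_coordinates:
  assumes "homogeneous_decomposition G T R"
  obtains J :: "(group_type \<times> nat) set" and S \<psi>
  where "finite J" and "\<And>j. j \<in> J \<Longrightarrow> fst j \<in> T \<and> S (fst j) \<in> fst j"
    and "rat_coordinates G J (\<lambda>j. S (fst j)) \<psi>"
    and "\<And>\<tau> x j. \<lbrakk>\<tau> \<in> T; x \<in> R \<tau>; j \<in> J; fst j \<noteq> \<tau>\<rbrakk> \<Longrightarrow> \<psi> j x = 0"
proof -
  have d: "direct_decomposition G T R"
    and hom: "\<And>\<rho>. \<rho> \<in> T \<Longrightarrow> homogeneous_of_type \<rho> (G\<lparr>carrier := R \<rho>\<rparr>)"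
    using assms by (auto simp: homogeneous_decomposition_def)
  have T: "finite T" and sub: "\<And>\<rho>. \<rho> \<in> T \<Longrightarrow> subgroup (R \<rho>) G"
    using d by (auto simp: direct_decomposition_def)
  obtain p where p: "\<And>i. i \<in> T \<Longrightarrow> p i \<in> hom G (G\<lparr>carrier := R i\<rparr>)"
    and p_prod: "\<And>x. x \<in> carrier G \<Longrightarrow> finprod G (\<lambda>i. p i x) T = x"
    and p_comp: "\<And>y i. y \<in> (\<Pi> i\<in>T. R i) \<Longrightarrow> i \<in> T \<Longrightarrow> p i (finprod G y T) = y i"
    by (rule direct_decomposition_components [OF d]) (rule that)
  have "\<forall>\<rho>\<in>T. \<exists>(n::nat) S \<psi>. (1 \<le> n \<longrightarrow> S \<in> \<rho>) \<and>
    rat_coordinates (G\<lparr>carrier := R \<rho>\<rparr>) {1..n} (\<lambda>_. S) \<psi>"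
    using comm_group.homogeneous_coordinates [OF subgroup_is_comm_group [OF sub] hom] by blast
  then obtain n :: "group_type \<Rightarrow> nat" and S \<theta>
    where S: "\<And>\<rho>. \<rho> \<in> T \<Longrightarrow> 1 \<le> n \<rho> \<Longrightarrow> S \<rho> \<in> \<rho>"
      and c: "\<And>\<rho>. \<rho> \<in> T \<Longrightarrow> rat_coordinates (G\<lparr>carrier := R \<rho>\<rparr>) {1..n \<rho>} (\<lambda>_. S \<rho>) (\<theta> \<rho>)"
    by metis
  define J where "J = (SIGMA \<rho>:T. {1..n \<rho>})"
  define \<psi> where "\<psi> = (\<lambda>(\<rho>, i) x. \<theta> \<rho> i (p \<rho> x))"
  have pR: "p \<rho> x \<in> R \<rho>" if "\<rho> \<in> T" "x \<in> carrier G" for \<rho> x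
    using p [OF that(1)] that(2) by (auto simp: hom_def)
  have c1: "subgroup (S \<rho>) rat_group" "\<theta> \<rho> i \<in> hom (G\<lparr>carrier := R \<rho>\<rparr>) (rat_group\<lparr>carrier := S \<rho>\<rparr>)"
    if "\<rho> \<in> T" "i \<in> {1..n \<rho>}" for \<rho> i
    using c [OF that(1)] that(2) by (auto simp: rat_coordinates_def)
  have "subgroup (S (fst j)) rat_group \<and> \<psi> j \<in> hom G (rat_group\<lparr>carrier := S (fst j)\<rparr>)" if "j \<in> J" for j
  proof -
    obtain \<rho> i where j: "j = (\<rho>, i)" "\<rho> \<in> T" "i \<in> {1..n \<rho>}" using \<open>j \<in> J\<close> by (auto simp: J_def)
    show ?thesis
      using Group.hom_compose [OF p [OF j(2)] c1(2) [OF j(2,3)]] c1(1) [OF j(2,3)]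
      by (simp add: \<psi>_def j(1) comp_def)
  qed
  moreover have "x = \<one>" if x: "x \<in> carrier G" and 0: "\<forall>j\<in>J. \<psi> j x = 0" for x
  proof -
    have "p \<rho> x = \<one>" if \<rho>: "\<rho> \<in> T" for \<rho>
    proof -
      have "\<forall>i\<in>{1..n \<rho>}. \<theta> \<rho> i (p \<rho> x) = 0" using 0 \<rho> by (force simp: J_def \<psi>_def)
      then show ?thesis using c [OF \<rho>] pR [OF \<rho> x] by (simp add: rat_coordinates_def)
    qed
    then have "finprod G (\<lambda>i. p i x) T = \<one>" by (intro finprod_one_eqI) auto
    then show ?thesis using p_prod [OF x] by simp
  qed
  moreover have "\<exists>x\<in>carrier G. \<forall>j\<in>J. \<psi> j x = v j" if v: "\<forall>j\<in>J. v j \<in> S (fst j)" for v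
  proof -
    have "\<exists>y\<in>R \<rho>. \<forall>i\<in>{1..n \<rho>}. \<theta> \<rho> i y = v (\<rho>, i)" if \<rho>: "\<rho> \<in> T" for \<rho>
    proof -
      have "\<forall>i\<in>{1..n \<rho>}. v (\<rho>, i) \<in> S \<rho>" using v \<rho> by (force simp: J_def)
      then show ?thesis using c [OF \<rho>] unfolding rat_coordinates_def by auto
    qed
    then obtain y where y: "\<And>\<rho>. \<rho> \<in> T \<Longrightarrow> y \<rho> \<in> R \<rho>"
      "\<And>\<rho> i. \<rho> \<in> T \<Longrightarrow> i \<in> {1..n \<rho>} \<Longrightarrow> \<theta> \<rho> i (y \<rho>) = v (\<rho>, i)"
      by metis
    have "finprod G y T \<in> carrier G"
      using y(1) sub subgroup.subset by (intro finprod_closed) fast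
    moreover have "\<psi> j (finprod G y T) = v j" if "j \<in> J" for j
      using that p_comp [of y] y by (auto simp: \<psi>_def J_def)
    ultimately show ?thesis by blast
  qed
  ultimately have "rat_coordinates G J (\<lambda>j. S (fst j)) \<psi>" by (simp add: rat_coordinates_def)
  moreover have "\<psi> j x = 0" if "\<tau> \<in> T" "x \<in> R \<tau>" and j: "j \<in> J" "fst j \<noteq> \<tau>" for \<tau> x j
  proof -
    obtain \<rho> i where ri: "j = (\<rho>, i)" "\<rho> \<in> T" "i \<in> {1..n \<rho>}" using j by (auto simp: J_def)
    have "p \<rho> x = \<one>"
      using component_of_summand [OF d p_comp \<open>\<tau> \<in> T\<close> ri(2) \<open>x \<in> R \<tau>\<close>] ri(1) j(2) by auto
    moreover have "\<theta> \<rho> i \<one> = 0"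
      using hom_one [OF c1(2) [OF ri(2,3)]] subgroup.subgroup_is_group [OF sub [OF ri(2)] is_group]
        subgroup.subgroup_is_group [OF c1(1) [OF ri(2,3)] group_rat_group] by simp
    ultimately show ?thesis by (simp add: \<psi>_def ri(1))
  qed
  moreover have "finite J" using T by (simp add: J_def)
  moreover have "fst j \<in> T \<and> S (fst j) \<in> fst j" if "j \<in> J" for j
    using that S by (auto simp: J_def)
  ultimately show ?thesis using that by blast
qed

section \<open>Exponent and generator modulo the regulator\<close>

lemma pow_index_mem:
  assumes H: "subgroup H G" and x: "x \<in> carrier G"
  shows "x [^] card (rcosets H) \<in> H"
proof -
  interpret H: normal H G using H by (rule subgroup_imp_normal)
  interpret f: group_hom G "G Mod H" "\<lambda>a. H #> a"
    using H.r_coset_hom_Mod H.factorgroup_is_group is_group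
    by (simp add: group_hom_def group_hom_axioms_def)
  let ?n = "card (rcosets H)"
  have "order (G Mod H) = ?n" by (simp add: order_def FactGroup_def)
  then have "H #> (x [^] ?n) = H"
    using group.pow_order_eq_1 [OF H.factorgroup_is_group f.hom_closed [OF x]] f.hom_nat_pow [OF x, of ?n]
    by (simp add: FactGroup_def)
  then show ?thesis using rcos_self [OF _ H, of "x [^] ?n"] x by simp
qed

text \<open>All regulating subgroups have the same, least index. By Lagrange the power with that
  exponent lies in each of them, hence in their intersection.\<close>

lemma regulator_subgroup_exponent:
  assumes "almost_completely_decomposable G"
  shows "subgroup (regulator G) G"
    and "\<exists>m::nat. 0 < m \<and> (\<forall>x\<in>carrier G. x [^] m \<in> regulator G)"
proof -
  have "\<exists>A. cd_finite_index G A" using assms by (simp add: almost_completely_decomposable_def)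
  then obtain A where A: "cd_finite_index G A"
    "\<And>B. cd_finite_index G B \<Longrightarrow> card (rcosets A) \<le> card (rcosets B)"
    using ex_has_least_nat [of "cd_finite_index G" _ "\<lambda>A. card (rcosets A)"] by blast
  then have rA: "regulating_subgroup G A" by (simp add: regulating_subgroup_def)
  have sub: "\<And>B. regulating_subgroup G B \<Longrightarrow> subgroup B G"
    by (simp add: regulating_subgroup_def cd_finite_index_def)
  show "subgroup (regulator G) G"
    unfolding regulator_def using rA sub by (intro subgroups_Inter) auto
  have "finite (rcosets A)" using A(1) by (simp add: cd_finite_index_def)
  moreover have "A #> \<one> \<in> rcosets A" using one_closed by (auto simp: RCOSETS_def)
  ultimately have "0 < card (rcosets A)" by (auto simp: card_gt_0_iff)
  moreover have "x [^] card (rcosets A) \<in> B" if "x \<in> carrier G" "regulating_subgroup G B" for x B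
  proof -
    have "card (rcosets A) = card (rcosets B)"
      using A that(2) by (intro antisym) (auto simp: regulating_subgroup_def)
    then show ?thesis using pow_index_mem [OF sub [OF that(2)] that(1)] by simp
  qed
  ultimately show "\<exists>m::nat. 0 < m \<and> (\<forall>x\<in>carrier G. x [^] m \<in> regulator G)"
    by (auto simp: regulator_def)
qed

lemma cyclic_quotient_generator:
  assumes H: "subgroup H G" and "cyclic_group (G Mod H)"
  obtains g where "g \<in> carrier G" and "\<And>x. x \<in> carrier G \<Longrightarrow> \<exists>k::int. x \<otimes> inv (g [^] k) \<in> H"
proof -
  interpret H: normal H G using H by (rule subgroup_imp_normal)
  interpret f: group_hom G "G Mod H" "\<lambda>a. H #> a"
    using H.r_coset_hom_Mod H.factorgroup_is_group is_group
    by (simp add: group_hom_def group_hom_axioms_def)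
  obtain c where c: "c \<in> carrier (G Mod H)" "carrier (G Mod H) = range (\<lambda>n::int. c [^]\<^bsub>G Mod H\<^esub> n)"
    using assms(2) group.cyclic_group [OF H.factorgroup_is_group] by blast
  obtain g where g: "g \<in> carrier G" "c = H #> g"
    using c(1) by (auto simp: FactGroup_def RCOSETS_def)
  have "\<exists>k::int. x \<otimes> inv (g [^] k) \<in> H" if x: "x \<in> carrier G" for x
  proof -
    obtain k :: int where "H #> x = c [^]\<^bsub>G Mod H\<^esub> k"
      using f.hom_closed [OF x] c(2) by auto
    then have "H #> x = H #> (g [^] k)" using f.hom_int_pow [OF g(1), of k] g(2) by simp
    then have "x \<in> H #> (g [^] k)" using rcos_self [OF x H] by simp
    then obtain h where h: "h \<in> H" "x = h \<otimes> g [^] k" by (auto simp: r_coset_def)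
    then have "x \<otimes> inv (g [^] k) = h"
      using g(1) subgroup.mem_carrier [OF H h(1)] by (simp add: m_assoc)
    then show ?thesis using h(1) by blast
  qed
  then show ?thesis using that g(1) by blast
qed

end

section \<open>Ranks of the homogeneous components\<close>

lemma block_rank_le_number_of_summands:
  fixes G :: "('a, 'b) monoid_scheme" (structure) and s :: nat
  assumes "class_B G"
    and hd: "homogeneous_decomposition (G\<lparr>carrier := regulator G\<rparr>) (regulator_types G) R"
    and ind: "indecomposable_decomposition G s B"
    and \<tau>: "\<tau> \<in> regulator_types G"
  shows "group_rank (G\<lparr>carrier := R \<tau>\<rparr>) \<le> s"
proof -
  have acd: "almost_completely_decomposable G" and br: "block_rigid G"
    and cyc: "cyclic_group (G Mod regulator G)"
    using assms(1) by (auto simp: class_B_def)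
  interpret comm_group G
    using acd by (simp add: almost_completely_decomposable_def tffr_group_def)
  define N where "N = regulator G"
  let ?A = "G\<lparr>carrier := N\<rparr>" and ?T = "regulator_types G"
  have N: "subgroup N G" unfolding N_def by (rule regulator_subgroup_exponent [OF acd])
  have NG: "x \<in> carrier G" if "x \<in> N" for x using subgroup.mem_carrier [OF N that] .
  obtain m :: nat where m: "0 < m" "\<And>x. x \<in> carrier G \<Longrightarrow> x [^] m \<in> N"
    using regulator_subgroup_exponent(2) [OF acd] by (auto simp: N_def)
  have tf: "x = \<one>" if "x \<in> carrier G" "x [^] m = \<one>" for x
    using acd m(1) that
    by (auto simp: almost_completely_decomposable_def tffr_group_def torsion_free_group_def)
  obtain g where g: "g \<in> carrier G" "\<And>x. x \<in> carrier G \<Longrightarrow> \<exists>k::int. x \<otimes> inv (g [^] k) \<in> N"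
    using cyclic_quotient_generator [OF N] cyc unfolding N_def by blast
  interpret A: comm_group ?A using subgroup_is_comm_group [OF N] .
  have hd': "homogeneous_decomposition ?A ?T R" using hd by (simp add: N_def)
  obtain J :: "(group_type \<times> nat) set" and S \<psi> where J: "finite J"
    and S: "\<And>j. j \<in> J \<Longrightarrow> fst j \<in> ?T \<and> S (fst j) \<in> fst j"
    and c: "rat_coordinates ?A J (\<lambda>j. S (fst j)) \<psi>"
    and R0: "\<And>\<tau> x j. \<lbrakk>\<tau> \<in> ?T; x \<in> R \<tau>; j \<in> J; fst j \<noteq> \<tau>\<rbrakk> \<Longrightarrow> \<psi> j x = 0"
    by (rule A.homogeneous_decomposition_coordinates [OF hd']) (rule that)
  have S_sub: "subgroup (S (fst j)) rat_group"
    and \<psi>S: "\<And>x. x \<in> N \<Longrightarrow> \<psi> j x \<in> S (fst j)" and \<psi>_hom: "\<psi> j \<in> hom ?A rat_group" if "j \<in> J" for j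
    using c that by (auto simp: rat_coordinates_def hom_def)
  have \<psi>_inj: "x = \<one>" if "x \<in> N" "\<And>j. j \<in> J \<Longrightarrow> \<psi> j x = 0" for x
    using c that by (simp add: rat_coordinates_def)
  have \<psi>_surj: "\<exists>x\<in>N. \<forall>j\<in>J. \<psi> j x = v j" if "\<And>j. j \<in> J \<Longrightarrow> v j \<in> S (fst j)" for v
    using c that by (simp add: rat_coordinates_def)
  \<comment> \<open>The coordinates \<open>\<psi>\<close> are given on the regulator only;
    \<open>x [^] m\<close> lies there, and division by \<open>m\<close> undoes the power. Entries
    outside \<open>J\<close> are 0, as in a box.\<close>
  define \<phi> where "\<phi> = (\<lambda>x j. if j \<in> J then \<psi> j (x [^] m) / of_nat m else 0)"
  have \<phi>_hom: "(\<lambda>x. \<phi> x j) \<in> hom G rat_group" for j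
  proof (rule homI)
    fix x y assume xy: "x \<in> carrier G" "y \<in> carrier G"
    show "\<phi> (x \<otimes> y) j = \<phi> x j \<otimes>\<^bsub>rat_group\<^esub> \<phi> y j"
    proof (cases "j \<in> J")
      case True
      then show ?thesis
        using A.hom_rat_mult [OF \<psi>_hom [OF True], of "x [^] m" "y [^] m"] m(2) xy
        by (simp add: \<phi>_def nat_pow_distrib add_divide_distrib)
    qed (simp add: \<phi>_def)
  qed simp
  have \<phi>_mult: "\<phi> (x \<otimes> y) = \<phi> x + \<phi> y" if "x \<in> carrier G" "y \<in> carrier G" for x y
    using hom_rat_mult [OF \<phi>_hom that] by (simp add: fun_eq_iff)
  have \<phi>_one: "\<phi> \<one> = 0" using hom_rat_one [OF \<phi>_hom] by (simp add: fun_eq_iff)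
  have \<phi>_inv: "\<phi> (inv x) = - \<phi> x" if "x \<in> carrier G" for x
    using hom_rat_inv [OF \<phi>_hom that] by (simp add: fun_eq_iff)
  have \<phi>_pow: "\<phi> (x [^] k) = smul (of_int k) (\<phi> x)" if "x \<in> carrier G" for x and k :: int
    using hom_rat_int_pow [OF \<phi>_hom that] by (simp add: fun_eq_iff)
  have \<phi>_N: "\<phi> x j = \<psi> j x" if "x \<in> N" "j \<in> J" for x j
    using A.hom_rat_nat_pow [OF \<psi>_hom [OF that(2)], of x m] that m(1)
    by (simp add: \<phi>_def nat_pow_consistent [symmetric])
  have \<phi>_ker: "x = \<one>" if x: "x \<in> carrier G" "\<phi> x = 0" for x
  proof -
    have "\<psi> j (x [^] m) = 0" if "j \<in> J" for j
      using fun_cong [OF x(2), of j] that m(1) by (simp add: \<phi>_def)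
    then show ?thesis using tf [OF x(1)] \<psi>_inj [OF m(2) [OF x(1)]] by blast
  qed
  have \<phi>_inj: "inj_on \<phi> (carrier G)"
  proof (rule inj_onI)
    fix x y assume xy: "x \<in> carrier G" "y \<in> carrier G" "\<phi> x = \<phi> y"
    then have "\<phi> (x \<otimes> inv y) = 0" by (simp add: \<phi>_mult \<phi>_inv)
    then have "x \<otimes> inv y = \<one>" using \<phi>_ker xy by simp
    then show "x = y" using xy by (metis inv_equality inv_inv inv_closed)
  qed
  define X where "X = \<phi> ` carrier G"
  have \<phi>_box: "\<phi> x \<in> box J (S \<circ> fst)" if "x \<in> N" for x
    using \<phi>_N [OF that] \<psi>S that by (auto simp: box_def) (simp add: \<phi>_def)
  interpret cyclic_over_box J fst S X "int m" "\<phi> g"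
  proof
    show "finite J" by (rule J)
    show "diff_closed (S (fst j))" if "j \<in> J" for j
      using subgroup_rat_group_diff_closed [OF S_sub [OF that]] .
    show "diff_closed X"
      unfolding diff_closed_def
    proof (intro conjI ballI)
      show "0 \<in> X" using \<phi>_one by (force simp: X_def)
      fix v w assume "v \<in> X" "w \<in> X"
      then obtain x y where xy: "x \<in> carrier G" "y \<in> carrier G" "v = \<phi> x" "w = \<phi> y"
        by (auto simp: X_def)
      then have "v - w = \<phi> (x \<otimes> inv y)" by (simp add: \<phi>_mult \<phi>_inv)
      then show "v - w \<in> X" using xy by (simp add: X_def)
    qed
    show "x j = 0" if "x \<in> X" "j \<notin> J" for x j using that by (auto simp: X_def \<phi>_def)
    show "box J (S \<circ> fst) \<subseteq> X"
    proof
      fix v assume v: "v \<in> box J (S \<circ> fst)"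
      then obtain x where x: "x \<in> N" "\<forall>j\<in>J. \<psi> j x = v j"
        using \<psi>_surj [of v] by (auto simp: box_def)
      have "v = \<phi> x"
      proof (rule ext)
        fix j
        show "v j = \<phi> x j"
        proof (cases "j \<in> J")
          case True
          then show ?thesis using x \<phi>_N by simp
        next
          case False
          then have "v j = 0" using v unfolding box_def by blast
          then show ?thesis using False by (simp add: \<phi>_def)
        qed
      qed
      then show "v \<in> X" using NG [OF x(1)] by (simp add: X_def)
    qed
    show "0 < int m" using m(1) by simp
    show "smul (of_int (int m)) x \<in> box J (S \<circ> fst)" if "x \<in> X" for x
    proof -
      obtain y where y: "y \<in> carrier G" "x = \<phi> y" using \<open>x \<in> X\<close> by (auto simp: X_def)
      have "\<phi> (y [^] m) \<in> box J (S \<circ> fst)" using \<phi>_box m(2) y(1) by blast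
      then show ?thesis using \<phi>_pow [OF y(1), of "int m"] y(2) by (simp add: int_pow_int)
    qed
    show "\<phi> g \<in> X" using g(1) by (simp add: X_def)
    show "\<exists>k::int. x - smul (of_int k) (\<phi> g) \<in> box J (S \<circ> fst)" if "x \<in> X" for x
    proof -
      obtain y where y: "y \<in> carrier G" "x = \<phi> y" using \<open>x \<in> X\<close> by (auto simp: X_def)
      obtain k :: int where "y \<otimes> inv (g [^] k) \<in> N" using g(2) [OF y(1)] by blast
      then have "\<phi> (y \<otimes> inv (g [^] k)) \<in> box J (S \<circ> fst)" by (rule \<phi>_box)
      moreover have "\<phi> (y \<otimes> inv (g [^] k)) = x - smul (of_int k) (\<phi> g)"
        using y g(1) by (simp add: \<phi>_mult \<phi>_inv \<phi>_pow)
      ultimately show ?thesis by auto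
    qed
    \<comment> \<open>A nonzero value would witness \<open>type_le\<close> between two distinct
      critical types, each represented by its chosen subgroup of the rationals.\<close>
    show "f r = 0"
      if ij: "i \<in> J" "j \<in> J" "fst i \<noteq> fst j" and f: "f ` S (fst i) \<subseteq> S (fst j)"
        "additive_on (S (fst i)) f" and r: "r \<in> S (fst i)" for i j f r
    proof (rule ccontr)
      assume "f r \<noteq> 0"
      moreover have "f \<in> hom (rat_group\<lparr>carrier := S (fst i)\<rparr>) (rat_group\<lparr>carrier := S (fst j)\<rparr>)"
        using f by (auto simp: hom_def additive_on_def)
      ultimately have "type_le (fst i) (fst j)" 
        using S [OF ij(1)] S [OF ij(2)] r unfolding type_le_def by blast
      then show False using br S [OF ij(1)] S [OF ij(2)] ij(3) unfolding block_rigid_def by blast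
    qed
  qed
  have d: "direct_decomposition G {1..s} B"
    and ind_B: "\<And>i. i \<in> {1..s} \<Longrightarrow> indecomposable_group (G\<lparr>carrier := B i\<rparr>)"
    using ind by (auto simp: indecomposable_decomposition_def)
  have sub: "subgroup (B i) G" if "i \<in> {1..s}" for i
    using d that by (auto simp: direct_decomposition_def)
  obtain p where p: "\<And>i. i \<in> {1..s} \<Longrightarrow> p i \<in> hom G (G\<lparr>carrier := B i\<rparr>)"
    and p_prod: "\<And>x. x \<in> carrier G \<Longrightarrow> finprod G (\<lambda>i. p i x) {1..s} = x"
    and p_comp: "\<And>y i. y \<in> (\<Pi> i\<in>{1..s}. B i) \<Longrightarrow> i \<in> {1..s} \<Longrightarrow> p i (finprod G y {1..s}) = y i"
    by (rule direct_decomposition_components [OF d]) (rule that)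
  have pB: "p i x \<in> B i" and p_mult: "y \<in> carrier G \<Longrightarrow> p i (x \<otimes> y) = p i x \<otimes> p i y"
    if "i \<in> {1..s}" "x \<in> carrier G" for i x y
    using p [OF that(1)] that(2) by (auto simp: hom_def)
  have BG: "x \<in> carrier G" if "i \<in> {1..s}" "x \<in> B i" for i x
    using subgroup.mem_carrier [OF sub [OF that(1)] that(2)] .
  have pp: "p i x = x" if "i \<in> {1..s}" "x \<in> B i" for i x
    using component_of_summand [OF d p_comp that(1,1,2)] by simp
  define \<phi>i where "\<phi>i = inv_into (carrier G) \<phi>"
  have \<phi>i: "\<phi>i (\<phi> x) = x" if "x \<in> carrier G" for x
    using inv_into_f_f [OF \<phi>_inj that] by (simp add: \<phi>i_def)
  \<comment> \<open>The projections of the given decomposition, transported to coordinates; they are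
    meaningful on \<open>X\<close>, where \<open>\<phi>i\<close> inverts
    \<open>\<phi>\<close>.\<close>
  define \<pi> where "\<pi> = (\<lambda>i v. \<phi> (p i (\<phi>i v)))"
  have \<pi>: "\<pi> i (\<phi> x) = \<phi> (p i x)" if "x \<in> carrier G" for i x
    using \<phi>i [OF that] by (simp add: \<pi>_def)
  have "\<exists>f :: (group_type \<times> nat \<Rightarrow> rat) \<Rightarrow> rat. (\<forall>v w. f (v + w) = f v + f w) \<and>
    (\<forall>v\<in>block \<tau>. f (\<pi> i v) = 0 \<longrightarrow> \<pi> i v = 0)" if i: "i \<in> {1..s}" for i
  proof (rule indecomposable_image_rank_one)
    show "\<pi> i ` X \<subseteq> X" using \<pi> pB [OF i] BG [OF i] by (auto simp: X_def)
    show "additive_on X (\<pi> i)"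
      unfolding additive_on_def
    proof (intro ballI)
      fix v w assume "v \<in> X" "w \<in> X"
      then obtain x y where xy: "x \<in> carrier G" "y \<in> carrier G" "v = \<phi> x" "w = \<phi> y"
        by (auto simp: X_def)
      then have "\<pi> i (v + w) = \<phi> (p i (x \<otimes> y))" using \<pi> [of "x \<otimes> y"] by (simp add: \<phi>_mult)
      then show "\<pi> i (v + w) = \<pi> i v + \<pi> i w"
        using xy \<pi> p_mult [OF i] \<phi>_mult BG [OF i pB [OF i]] by simp
    qed
    show "\<pi> i (\<pi> i v) = \<pi> i v" if "v \<in> X" for v
      using that \<pi> pB [OF i] BG [OF i] pp [OF i] by (auto simp: X_def)
    have im: "\<pi> i ` X = \<phi> ` B i"
    proof (intro equalityI subsetI)
      show "v \<in> \<phi> ` B i" if "v \<in> \<pi> i ` X" for v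
        using that \<pi> pB [OF i] by (auto simp: X_def)
      show "v \<in> \<pi> i ` X" if "v \<in> \<phi> ` B i" for v
      proof -
        obtain x where x: "x \<in> B i" "v = \<phi> x" using \<open>v \<in> \<phi> ` B i\<close> by blast
        then have "v = \<pi> i (\<phi> x)" using \<pi> BG [OF i] pp [OF i] by simp
        then show ?thesis using x BG [OF i] by (auto simp: X_def)
      qed
    qed
    fix \<epsilon>
    assume \<epsilon>: "\<epsilon> ` \<pi> i ` X \<subseteq> \<pi> i ` X" "additive_on (\<pi> i ` X) \<epsilon>"
      "\<And>v. v \<in> \<pi> i ` X \<Longrightarrow> \<epsilon> (\<epsilon> v) = \<epsilon> v"
    \<comment> \<open>The idempotent is carried back to the summand \<open>B i\<close>, where
      indecomposability applies.\<close>
    define e where "e = (\<lambda>x. \<phi>i (\<epsilon> (\<phi> x)))"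
    have e: "e x \<in> B i" "\<phi> (e x) = \<epsilon> (\<phi> x)" if "x \<in> B i" for x
    proof -
      have "\<epsilon> (\<phi> x) \<in> \<phi> ` B i" using \<epsilon>(1) that unfolding im by blast
      then obtain y where "y \<in> B i" "\<epsilon> (\<phi> x) = \<phi> y" by blast
      then show "e x \<in> B i" "\<phi> (e x) = \<epsilon> (\<phi> x)" using \<phi>i BG [OF i] by (auto simp: e_def)
    qed
    interpret Bi: comm_group "G\<lparr>carrier := B i\<rparr>" using subgroup_is_comm_group [OF sub [OF i]] .
    have "(\<forall>x\<in>carrier (G\<lparr>carrier := B i\<rparr>). e x = \<one>\<^bsub>G\<lparr>carrier := B i\<rparr>\<^esub>) \<or>
      (\<forall>x\<in>carrier (G\<lparr>carrier := B i\<rparr>). e x = x)"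
    proof (rule Bi.indecomposable_idempotent [OF ind_B [OF i]])
      show "e \<in> hom (G\<lparr>carrier := B i\<rparr>) (G\<lparr>carrier := B i\<rparr>)"
      proof (rule homI)
        fix x y assume "x \<in> carrier (G\<lparr>carrier := B i\<rparr>)" "y \<in> carrier (G\<lparr>carrier := B i\<rparr>)"
        then have xy: "x \<in> B i" "y \<in> B i" by simp_all
        have xy': "x \<otimes> y \<in> B i" using subgroup.m_closed [OF sub [OF i] xy] .
        have "\<phi> (e (x \<otimes> y)) = \<epsilon> (\<phi> x + \<phi> y)"
          using e(2) [OF xy'] \<phi>_mult xy BG [OF i] by simp
        also have "\<dots> = \<epsilon> (\<phi> x) + \<epsilon> (\<phi> y)"
          using additive_onD [OF \<epsilon>(2)] xy unfolding im by blast
        also have "\<dots> = \<phi> (e x \<otimes> e y)" using e xy \<phi>_mult BG [OF i] by simp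
        finally have "e (x \<otimes> y) = e x \<otimes> e y"
          using \<phi>_inj e(1) xy xy' BG [OF i] by (auto dest: inj_onD)
        then show "e (x \<otimes>\<^bsub>G\<lparr>carrier := B i\<rparr>\<^esub> y) = e x \<otimes>\<^bsub>G\<lparr>carrier := B i\<rparr>\<^esub> e y" by simp
      qed (simp add: e(1))
      fix x assume "x \<in> carrier (G\<lparr>carrier := B i\<rparr>)"
      then have x: "x \<in> B i" by simp
      have "\<phi> (e (e x)) = \<phi> (e x)" using e x \<epsilon>(3) [of "\<phi> x"] unfolding im by simp
      then show "e (e x) = e x" using \<phi>_inj e(1) x BG [OF i] by (auto dest: inj_onD)
    qed
    then show "(\<forall>v\<in>\<pi> i ` X. \<epsilon> v = 0) \<or> (\<forall>v\<in>\<pi> i ` X. \<epsilon> v = v)"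
      using e(2) \<phi>_one unfolding im by force
  qed
  then obtain f :: "nat \<Rightarrow> (group_type \<times> nat \<Rightarrow> rat) \<Rightarrow> rat"
    where f_add: "\<And>i v w. i \<in> {1..s} \<Longrightarrow> f i (v + w) = f i v + f i w"
      and f_ker: "\<And>i v. i \<in> {1..s} \<Longrightarrow> v \<in> block \<tau> \<Longrightarrow> f i (\<pi> i v) = 0 \<Longrightarrow> \<pi> i v = 0"
    by metis
  have R\<tau>: "subgroup (R \<tau>) ?A"
    using hd' \<tau> by (auto simp: homogeneous_decomposition_def direct_decomposition_def)
  have R_sub: "subgroup (R \<tau>) G" using incl_subgroup [OF N R\<tau>] .
  have RG: "x \<in> carrier G" if "x \<in> R \<tau>" for x using subgroup.mem_carrier [OF R_sub that] .
  have RN: "x \<in> N" if "x \<in> R \<tau>" for x using subgroup.mem_carrier [OF R\<tau> that] by simp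
  interpret R: comm_group "G\<lparr>carrier := R \<tau>\<rparr>" using subgroup_is_comm_group [OF R_sub] .
  \<comment> \<open>There is one functional per summand. An element of \<open>R \<tau>\<close>
    killed by all of them has trivial component in every summand and is therefore trivial.\<close>
  have "group_rank (G\<lparr>carrier := R \<tau>\<rparr>) \<le> card {1..s}"
  proof (rule R.group_rank_le)
    show "finite {1..s}" by simp
    show "(\<lambda>x. f i (\<phi> (p i x))) \<in> hom (G\<lparr>carrier := R \<tau>\<rparr>) rat_group" if i: "i \<in> {1..s}" for i
      using RG f_add [OF i] p_mult [OF i] \<phi>_mult BG [OF i pB [OF i]] by (auto simp: hom_def)
    fix x assume x': "x \<in> carrier (G\<lparr>carrier := R \<tau>\<rparr>)"
      and 0: "\<And>i. i \<in> {1..s} \<Longrightarrow> f i (\<phi> (p i x)) = 0"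
    have x: "x \<in> R \<tau>" "x \<in> carrier G" using x' RG by auto
    have "\<phi> x j = 0" if "fst j \<noteq> \<tau>" for j
    proof (cases "j \<in> J")
      case True
      then show ?thesis using R0 [OF \<tau> x(1) True that] \<phi>_N [OF RN [OF x(1)] True] by simp
    qed (simp add: \<phi>_def)
    then have "part fst \<tau> (\<phi> x) = \<phi> x" by (auto simp: part_def)
    moreover have "\<phi> x \<in> X" using x(2) by (simp add: X_def)
    ultimately have "\<phi> x \<in> block \<tau>" by (simp add: block_def)
    then have "\<phi> (p i x) = 0" if "i \<in> {1..s}" for i
      using f_ker [OF that, of "\<phi> x"] 0 [OF that] \<pi> [OF x(2)] by simp
    then have "p i x = \<one>" if "i \<in> {1..s}" for i
      using \<phi>_ker BG [OF that pB [OF that x(2)]] that by blast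
    then have "finprod G (\<lambda>i. p i x) {1..s} = \<one>" by (intro finprod_one_eqI) auto
    then show "x = \<one>\<^bsub>G\<lparr>carrier := R \<tau>\<rparr>\<^esub>" using p_prod [OF x(2)] by simp
  qed
  then show ?thesis by simp
qed

theorem lemma6p1:
  fixes G :: "('a, 'b) monoid_scheme"
    and R :: "group_type \<Rightarrow> 'a set"
  assumes "class_B G"
    and "homogeneous_decomposition (G\<lparr>carrier := regulator G\<rparr>) (regulator_types G) R"
  shows "(\<forall>(s::nat) B. indecomposable_decomposition G s B \<longrightarrow>
            (\<forall>\<tau> \<in> regulator_types G. group_rank (G\<lparr>carrier := R \<tau>\<rparr>) \<le> s)) \<and>
         (\<forall>r1 r2. realizes_partition G {#r1, r2#} \<longrightarrow>
            (\<forall>\<tau> \<in> regulator_types G. group_rank (G\<lparr>carrier := R \<tau>\<rparr>) \<le> 2))"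
proof -
  have le: "group_rank (G\<lparr>carrier := R \<tau>\<rparr>) \<le> s"
    if "indecomposable_decomposition G s B" "\<tau> \<in> regulator_types G" for s B \<tau>
    using block_rank_le_number_of_summands [OF assms that] .
  moreover have "group_rank (G\<lparr>carrier := R \<tau>\<rparr>) \<le> 2"
    if real: "realizes_partition G {#r1, r2#}" and \<tau>: "\<tau> \<in> regulator_types G" for r1 r2 \<tau>
  proof -
    obtain s B where s: "indecomposable_decomposition G s B"
      "{#r1, r2#} = image_mset (\<lambda>i. group_rank (G\<lparr>carrier := B i\<rparr>)) (mset_set {1..s})"
      using real unfolding realizes_partition_def by blast
    \<comment> \<open>Parts are counted with multiplicity, one per summand, so two parts mean two
      summands.\<close>
    from arg_cong [OF s(2), of size] have "s = 2" by simp
    then show ?thesis using le [OF s(1) \<tau>] by simp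
  qed
  ultimately show ?thesis by blast
qed

end
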